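(* Let $m,n$ be nonnegative integers with $2m+n\ge 1$ and let $c$ be a positive integer. Write $6m+3n+1=\alpha 2^k$ with $\alpha$ odd and $k\ge 0$ an integer. Then there exists a $c$-fold $1$-perfect code in the Doob graph $D(m,n)$ if and only if (1) $2m+n\equiv 1 \pmod 4$, and (2) $c=\alpha l$ for some $l\in\{1,\ldots,2^k\}$.
   Context: The Shrikhande graph is the Cayley graph on $\mathbb{Z}_4^2$ with connection set $\{01,03,10,30,11,33\}$ (two vertices are adjacent iff their difference lies in this set). For nonnegative integers $m,n$, $D(m,n)$ is the Cartesian product of $m$ copies of the Shrikhande graph and $n$ copies of the complete graph $K_4$; its vertex set is $(\mathbb{Z}_4^2)^m\times \mathbb{Z}_4^n$ and two vertices are adjacent iff they differ in exactly one coordinate and the two entries in that coordinate are adjacent in the corresponding factor. $D(0,n)$ is the Hamming graph $H(n,4)$. $D(m,n)$ is $(6m+3n)$-regular. Distance is shortest-path distance. A code is a nonempty set of vertices. For a positive integer $\mu$, a code $C$ is $\mu$-fold $1$-perfect if every closed ball of radius $1$ (a vertex together with its neighbours) contains exactly $\mu$ vertices of $C$.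
   Formalization: The case c = 6m+3n+1 is added as an alternative to (1) and (2): the whole vertex set is always such a code, so the printed equivalence fails there when 2m+n is not 1 mod 4 (e.g. D(0,2), c = 7). *)

theory Defs
  imports
    "HOL-Library.Numeral_Type"
    "HOL-Library.Product_Plus"
    "HOL-Number_Theory.Cong"
begin

text \<open>
  The numeral type \<^typ>\<open>4\<close> is the ring of integers modulo 4, and \<^typ>\<open>4 \<times> 4\<close> carries the
  componentwise group structure.
\<close>

definition shrikhande_conn :: "(4 \<times> 4) set" where
  "shrikhande_conn = {(0, 1), (0, 3), (1, 0), (3, 0), (1, 1), (3, 3)}"

definition shrikhande_adj :: "4 \<times> 4 \<Rightarrow> 4 \<times> 4 \<Rightarrow> bool" where
  "shrikhande_adj x y \<longleftrightarrow> y - x \<in> shrikhande_conn"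

definition K4_adj :: "4 \<Rightarrow> 4 \<Rightarrow> bool" where
  "K4_adj x y \<longleftrightarrow> x \<noteq> y"

definition cart_power_adj :: "('a \<Rightarrow> 'a \<Rightarrow> bool) \<Rightarrow> 'a list \<Rightarrow> 'a list \<Rightarrow> bool" where
  "cart_power_adj A xs ys \<longleftrightarrow> length xs = length ys \<and>
     (\<exists>i<length xs. A (xs ! i) (ys ! i) \<and> (\<forall>j<length xs. j \<noteq> i \<longrightarrow> xs ! j = ys ! j))"

type_synonym doob_vertex = "(4 \<times> 4) list \<times> 4 list"

definition doob_verts :: "nat \<Rightarrow> nat \<Rightarrow> doob_vertex set" where
  "doob_verts m n = {(xs, ys). length xs = m \<and> length ys = n}"

definition doob_adj :: "doob_vertex \<Rightarrow> doob_vertex \<Rightarrow> bool" where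
  "doob_adj u v \<longleftrightarrow>
     (cart_power_adj shrikhande_adj (fst u) (fst v) \<and> snd u = snd v) \<or>
     (fst u = fst v \<and> cart_power_adj K4_adj (snd u) (snd v))"

definition unit_ball :: "'v set \<Rightarrow> ('v \<Rightarrow> 'v \<Rightarrow> bool) \<Rightarrow> 'v \<Rightarrow> 'v set" where
  "unit_ball V adj v = {u \<in> V. u = v \<or> adj v u}"

definition multifold_perfect_code ::
    "'v set \<Rightarrow> ('v \<Rightarrow> 'v \<Rightarrow> bool) \<Rightarrow> nat \<Rightarrow> 'v set \<Rightarrow> bool" where
  "multifold_perfect_code V adj \<mu> C \<longleftrightarrow>
     C \<noteq> {} \<and> C \<subseteq> V \<and> (\<forall>v\<in>V. card (C \<inter> unit_ball V adj v) = \<mu>)"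

lemma shrikhande_conn_uminus: "c \<in> shrikhande_conn \<Longrightarrow> - c \<in> shrikhande_conn"
  unfolding shrikhande_conn_def by auto

lemma shrikhande_adj_sym: "shrikhande_adj x y \<longleftrightarrow> shrikhande_adj y x"
  unfolding shrikhande_adj_def by (metis minus_diff_eq shrikhande_conn_uminus)

lemma not_shrikhande_adj_self: "\<not> shrikhande_adj x x"
  by (auto simp: shrikhande_adj_def shrikhande_conn_def zero_prod_def)

lemma card_shrikhande_nbrs: "card {y. shrikhande_adj x y} = 6"
proof -
  have "bij_betw (\<lambda>y. y - x) {y. shrikhande_adj x y} shrikhande_conn"
    by (rule bij_betw_byWitness[where f' = "\<lambda>c. c + x"]) (auto simp: shrikhande_adj_def)
  then have "card {y. shrikhande_adj x y} = card shrikhande_conn"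
    by (rule bij_betw_same_card)
  then show ?thesis by (simp add: shrikhande_conn_def)
qed

lemma card_K4_nbrs: "card {y. K4_adj x y} = 3"
proof -
  have "{y. K4_adj x y} = UNIV - {x}" by (auto simp: K4_adj_def)
  then show ?thesis by (simp add: card_Diff_singleton)
qed

lemma card_cart_power_nbrs:
  fixes A :: "'a::finite \<Rightarrow> 'a \<Rightarrow> bool"
  assumes irrefl: "\<And>x. \<not> A x x" and deg: "\<And>x. card {y. A x y} = d"
  shows "finite {ys. cart_power_adj A xs ys}" "card {ys. cart_power_adj A xs ys} = length xs * d"
proof -
  let ?N = "\<lambda>i. (\<lambda>b. xs[i := b]) ` {b. A (xs ! i) b}"
  have eq: "{ys. cart_power_adj A xs ys} = (\<Union>i\<in>{..<length xs}. ?N i)"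
  proof (intro equalityI subsetI)
    fix ys assume "ys \<in> {ys. cart_power_adj A xs ys}"
    then obtain i where i: "length xs = length ys" "i < length xs" "A (xs ! i) (ys ! i)"
      "\<forall>j<length xs. j \<noteq> i \<longrightarrow> xs ! j = ys ! j"
      by (auto simp: cart_power_adj_def)
    have "ys = xs[i := ys ! i]"
      using i by (intro nth_equalityI) (auto simp: nth_list_update)
    then show "ys \<in> (\<Union>i\<in>{..<length xs}. ?N i)" using i by blast
  qed (auto simp: cart_power_adj_def)
  have card_N: "card (?N i) = d" if "i < length xs" for i
  proof -
    have "inj_on (\<lambda>b. xs[i := b]) {b. A (xs ! i) b}"
      by (rule inj_onI) (metis nth_list_update_eq that)
    then show ?thesis by (simp add: card_image deg)
  qed
  have disj: "?N i \<inter> ?N j = {}" if ij: "i < length xs" "j < length xs" "i \<noteq> j" for i j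
  proof (rule ccontr)
    assume "?N i \<inter> ?N j \<noteq> {}"
    then obtain a b where a: "A (xs ! i) a" and e: "xs[i := a] = xs[j := b]" by blast
    have "a = xs ! i" using arg_cong[OF e, of "\<lambda>zs. zs ! i"] ij by simp
    with a irrefl show False by metis
  qed
  show "finite {ys. cart_power_adj A xs ys}" unfolding eq by simp
  have "card (\<Union>i\<in>{..<length xs}. ?N i) = (\<Sum>i\<in>{..<length xs}. card (?N i))"
    using disj by (intro card_UN_disjoint) auto
  then show "card {ys. cart_power_adj A xs ys} = length xs * d"
    unfolding eq using card_N by simp
qed

lemma card_doob_unit_ball:
  assumes "v \<in> doob_verts m n"
  shows "card (unit_ball (doob_verts m n) doob_adj v) = 6 * m + 3 * n + 1"
proof -
  obtain xs ys where v: "v = (xs, ys)" "length xs = m" "length ys = n"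
    using assms by (cases v) (simp add: doob_verts_def)
  let ?S = "{zs. cart_power_adj shrikhande_adj xs zs}"
  let ?K = "{zs. cart_power_adj K4_adj ys zs}"
  have irr: "\<And>x. \<not> K4_adj x x" by (simp add: K4_adj_def)
  have S: "finite ?S" "card ?S = length xs * 6"
    using card_cart_power_nbrs[of shrikhande_adj 6 xs] not_shrikhande_adj_self card_shrikhande_nbrs
    by blast+
  have K: "finite ?K" "card ?K = length ys * 3"
    using card_cart_power_nbrs[of K4_adj 3 ys] irr card_K4_nbrs
    by blast+
  have ns: "xs \<notin> ?S" by (simp add: cart_power_adj_def not_shrikhande_adj_self)
  have nk: "ys \<notin> ?K" by (simp add: cart_power_adj_def irr)
  have len: "length zs = length ws" if "cart_power_adj A ws zs" for A :: "'x \<Rightarrow> 'x \<Rightarrow> bool" and ws zs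
    using that by (simp add: cart_power_adj_def)
  have eq: "unit_ball (doob_verts m n) doob_adj v = insert (xs, ys) (?S \<times> {ys} \<union> {xs} \<times> ?K)"
  proof (rule set_eqI)
    fix u :: doob_vertex
    obtain a b where u: "u = (a, b)" by (cases u)
    show "u \<in> unit_ball (doob_verts m n) doob_adj v \<longleftrightarrow>
          u \<in> insert (xs, ys) (?S \<times> {ys} \<union> {xs} \<times> ?K)"
      using v len[of shrikhande_adj xs a] len[of K4_adj ys b]
      by (simp add: u unit_ball_def doob_verts_def doob_adj_def) blast
  qed
  have fin: "finite (?S \<times> {ys} \<union> {xs} \<times> ?K)"
    by (intro finite_UnI finite_cartesian_product S(1) K(1)) simp_all
  have "(xs, ys) \<notin> ?S \<times> {ys} \<union> {xs} \<times> ?K"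
    using ns nk by blast
  then have "card (unit_ball (doob_verts m n) doob_adj v) = Suc (card (?S \<times> {ys} \<union> {xs} \<times> ?K))"
    unfolding eq using fin by (rule card_insert_disjoint[rotated])
  also have "card (?S \<times> {ys} \<union> {xs} \<times> ?K) = card (?S \<times> {ys}) + card ({xs} \<times> ?K)"
    using fin ns by (intro card_Un_disjoint) blast+
  also have "\<dots> = m * 6 + n * 3"
    unfolding card_cartesian_product S(2) K(2) v(2,3) by simp
  finally show ?thesis by simp
qed

text \<open>
  The whole vertex set is a \<open>(6m+3n+1)\<close>-fold 1-perfect code in every Doob graph \<open>D(m,n)\<close>, with
  no congruence condition on \<open>2m+n\<close>; this is why \<open>c = 6m+3n+1\<close> has to be treated separately in
  any criterion for existence.
\<close>

lemma doob_verts_multifold_perfect: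
  "multifold_perfect_code (doob_verts m n) doob_adj (6 * m + 3 * n + 1) (doob_verts m n)"
proof -
  have "(replicate m 0, replicate n 0) \<in> doob_verts m n"
    by (simp add: doob_verts_def)
  then have "doob_verts m n \<noteq> {}" by blast
  moreover have "doob_verts m n \<inter> unit_ball (doob_verts m n) doob_adj v
      = unit_ball (doob_verts m n) doob_adj v" for v
    by (auto simp: unit_ball_def)
  ultimately show ?thesis
    by (simp add: multifold_perfect_code_def card_doob_unit_ball)
qed

end

theory Submission
  imports Defs Complex_Main
begin

text \<open>
  Necessity. The indicator function of a code, minus its mean, is an eigenfunction of the adjacency
  matrix for the eigenvalue \<open>-1\<close> unless the code is everything. The Shrikhande graph has eigenvalues
  \<open>6, 2, -2\<close> and \<open>K\<^sub>4\<close> has \<open>3, -1\<close>, so all eigenvalues of \<open>D(m,n)\<close> are congruent to \<open>2m - n\<close>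
  modulo 4. Double counting gives \<open>\<alpha> dvd c\<close>.

  Sufficiency. It is enough to colour the vertices with \<open>2^k\<close> colours such that every ball contains
  every colour exactly \<open>\<alpha>\<close> times, since \<open>l\<close> colour classes then form a code. Writing
  \<open>2m + n = 4N + 1\<close>, the coordinates are divided into a part of weight \<open>N\<close> (a Shrikhande coordinate
  having weight 2), coloured recursively with \<open>2^(k-2)\<close> colours, and a part of weight \<open>3N + 1\<close>
  carrying a Latin colouring \<open>(S, R)\<close> with \<open>4 * 2^(k-2)\<close> colours: no neighbour of a vertex \<open>v\<close> has the
  same \<open>S\<close> as \<open>v\<close>, and every colour with another \<open>S\<close> occurs \<open>\<alpha>\<close> times around \<open>v\<close>. Latin colourings are
  glued from blocks consisting of Shrikhande coordinates only or of \<open>K\<^sub>4\<close> coordinates only; the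
  former use homomorphisms to \<open>Z\<^sub>4\<^sup>2\<close> or \<open>Z\<^sub>4\<^sup>2 \<times> Z\<^sub>2\<close>, the latter lines of a binary vector space. The
  recursion ends at \<open>k = 0\<close> or at \<open>k = 3\<close>, where the colouring takes values in \<open>Z\<^sub>2\<^sup>3\<close>; the graph \<open>D(1,3)\<close>
  needs a separate colouring by \<open>Z\<^sub>4\<^sup>2\<close>.
\<close>

subsection \<open>Sums over neighbourhoods\<close>

text \<open>Values lie in an arbitrary commutative monoid because colours are counted in
  \<open>nat\<close> while eigenfunctions are real.\<close>

definition nbr_sum :: "('a \<Rightarrow> 'a \<Rightarrow> bool) \<Rightarrow> ('a list \<Rightarrow> 'b::comm_monoid_add) \<Rightarrow> 'a list \<Rightarrow> 'b" where
  "nbr_sum A \<phi> xs = (\<Sum>ys | cart_power_adj A xs ys. \<phi> ys)"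

lemma finite_cart_power_nbrs:
  "finite {ys::'a::finite list. cart_power_adj A xs ys}"
  by (rule finite_subset[OF _ finite_lists_length_eq[of UNIV "length xs"]])
    (auto simp: cart_power_adj_def)

lemma cart_power_adj_Cons:
  "cart_power_adj A (x # xs) (y # ys) \<longleftrightarrow>
     (A x y \<and> xs = ys) \<or> (x = y \<and> cart_power_adj A xs ys)"
proof
  assume "cart_power_adj A (x # xs) (y # ys)"
  then obtain i where l: "length xs = length ys" and i: "i < Suc (length xs)"
    "A ((x # xs) ! i) ((y # ys) ! i)"
    and j: "\<And>j. j < Suc (length xs) \<Longrightarrow> j \<noteq> i \<Longrightarrow> (x # xs) ! j = (y # ys) ! j"
    by (auto simp: cart_power_adj_def)
  show "(A x y \<and> xs = ys) \<or> (x = y \<and> cart_power_adj A xs ys)"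
  proof (cases i)
    case 0
    have "xs = ys" using l j[of "Suc _"] 0 by (intro nth_equalityI) auto
    then show ?thesis using i 0 by simp
  next
    case (Suc k)
    have "x = y" using j[of 0] Suc by simp
    moreover have "cart_power_adj A xs ys"
      unfolding cart_power_adj_def using l i j[of "Suc _"] Suc by (intro conjI exI[of _ k]) auto
    ultimately show ?thesis by simp
  qed
next
  assume "(A x y \<and> xs = ys) \<or> (x = y \<and> cart_power_adj A xs ys)"
  then show "cart_power_adj A (x # xs) (y # ys)"
  proof
    assume "A x y \<and> xs = ys"
    then show ?thesis
      unfolding cart_power_adj_def by (intro conjI exI[of _ 0]) (auto simp: nth_Cons')
  next
    assume xy: "x = y \<and> cart_power_adj A xs ys"
    then obtain i where "length xs = length ys" "i < length xs" "A (xs ! i) (ys ! i)"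
      "\<forall>j<length xs. j \<noteq> i \<longrightarrow> xs ! j = ys ! j"
      by (auto simp: cart_power_adj_def)
    with xy show ?thesis
      unfolding cart_power_adj_def by (intro conjI exI[of _ "Suc i"]) (auto simp: nth_Cons')
  qed
qed

lemma nbr_sum_Nil [simp]: "nbr_sum A \<phi> [] = 0"
  by (simp add: nbr_sum_def cart_power_adj_def)

text \<open>Irreflexivity separates the neighbours that change the first entry from those that keep
  it.\<close>

lemma nbr_sum_Cons:
  fixes A :: "'a::finite \<Rightarrow> 'a \<Rightarrow> bool"
  assumes "\<And>x. \<not> A x x"
  shows "nbr_sum A \<phi> (x # xs) = (\<Sum>y | A x y. \<phi> (y # xs)) + nbr_sum A (\<lambda>zs. \<phi> (x # zs)) xs"
proof -
  let ?P = "(\<lambda>y. y # xs) ` {y. A x y}" and ?Q = "(#) x ` {ys. cart_power_adj A xs ys}"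
  have "{ys. cart_power_adj A (x # xs) ys} = ?P \<union> ?Q"
  proof (intro set_eqI)
    fix ys
    show "ys \<in> {ys. cart_power_adj A (x # xs) ys} \<longleftrightarrow> ys \<in> ?P \<union> ?Q"
      by (cases ys) (auto simp: cart_power_adj_Cons, auto simp: cart_power_adj_def)
  qed
  moreover have "?P \<inter> ?Q = {}" using assms by auto
  ultimately show ?thesis
    by (simp add: nbr_sum_def sum.union_disjoint finite_cart_power_nbrs sum.reindex inj_on_def)
qed

lemma nbr_sum_append:
  fixes A :: "'a::finite \<Rightarrow> 'a \<Rightarrow> bool"
  assumes "\<And>x. \<not> A x x"
  shows "nbr_sum A \<phi> (xs @ ys) =
    nbr_sum A (\<lambda>zs. \<phi> (zs @ ys)) xs + nbr_sum A (\<lambda>zs. \<phi> (xs @ zs)) ys"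
  by (induction xs arbitrary: \<phi>) (simp_all add: nbr_sum_Cons assms add.assoc)

lemma nbr_sum_cong:
  assumes "\<And>ys. length ys = length xs \<Longrightarrow> \<phi> ys = \<psi> ys"
  shows "nbr_sum A \<phi> xs = nbr_sum A \<psi> xs"
  unfolding nbr_sum_def by (rule sum.cong) (auto simp: cart_power_adj_def assms)

lemma not_K4_adj_self: "\<not> K4_adj x x"
  by (simp add: K4_adj_def)

text \<open>The adjacency operator A of \<open>D(m,n)\<close>, for all m and n at once, since
  adjacency preserves the lengths of both lists.\<close>

definition doob_sum :: "(doob_vertex \<Rightarrow> 'b::comm_monoid_add) \<Rightarrow> doob_vertex \<Rightarrow> 'b" where
  "doob_sum \<phi> v = nbr_sum shrikhande_adj (\<lambda>xs. \<phi> (xs, snd v)) (fst v)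
     + nbr_sum K4_adj (\<lambda>ys. \<phi> (fst v, ys)) (snd v)"

lemma doob_sum_cong:
  assumes "v \<in> doob_verts m n" "\<And>u. u \<in> doob_verts m n \<Longrightarrow> \<phi> u = \<psi> u"
  shows "doob_sum \<phi> v = doob_sum \<psi> v"
  unfolding doob_sum_def
  by (intro arg_cong2[of _ _ _ _ "(+)"] nbr_sum_cong assms(2))
    (use assms(1) in \<open>auto simp: doob_verts_def\<close>)

lemma finite_doob_verts: "finite (doob_verts m n)"
proof -
  have "doob_verts m n = {xs. length xs = m} \<times> {ys. length ys = n}"
    by (auto simp: doob_verts_def)
  then show ?thesis
    using finite_lists_length_eq[of "UNIV :: (4\<times>4) set" m] finite_lists_length_eq[of "UNIV :: 4 set" n]
    by simp
qed

lemma doob_verts_nonempty: "(replicate m 0, replicate n 0) \<in> doob_verts m n"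
  by (simp add: doob_verts_def)

text \<open>Balls become the operator \<open>I + A\<close>, so the condition on a code C reads
  \<open>(I + A) 1_C = c\<close>.\<close>

lemma sum_unit_ball:
  assumes "v \<in> doob_verts m n"
  shows "(\<Sum>u\<in>unit_ball (doob_verts m n) doob_adj v. \<phi> u) = \<phi> v + doob_sum \<phi> v"
proof -
  obtain xs ys where v: "v = (xs, ys)" and l: "length xs = m" "length ys = n"
    using assms by (auto simp: doob_verts_def)
  let ?P = "(\<lambda>a. (a, ys)) ` {a. cart_power_adj shrikhande_adj xs a}"
  let ?Q = "Pair xs ` {b. cart_power_adj K4_adj ys b}"
  have nx: "\<not> cart_power_adj shrikhande_adj xs xs"
    by (simp add: cart_power_adj_def not_shrikhande_adj_self)
  have ny: "\<not> cart_power_adj K4_adj ys ys"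
    by (simp add: cart_power_adj_def not_K4_adj_self)
  have "unit_ball (doob_verts m n) doob_adj v = insert v (?P \<union> ?Q)"
  proof (rule set_eqI)
    have len: "length zs = length ws" if "cart_power_adj A ws zs"
      for A :: "'x \<Rightarrow> 'x \<Rightarrow> bool" and ws zs
      using that by (simp add: cart_power_adj_def)
    fix u :: doob_vertex
    obtain a b where u: "u = (a, b)" by (cases u)
    show "u \<in> unit_ball (doob_verts m n) doob_adj v \<longleftrightarrow> u \<in> insert v (?P \<union> ?Q)"
      using v l len[of shrikhande_adj xs a] len[of K4_adj ys b]
      by (simp add: u unit_ball_def doob_verts_def doob_adj_def image_iff) blast
  qed
  moreover have "v \<notin> ?P \<union> ?Q" using nx ny by (auto simp: v)
  moreover have "?P \<inter> ?Q = {}" using nx by auto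
  ultimately show ?thesis
    by (simp add: sum.union_disjoint finite_cart_power_nbrs sum.reindex inj_on_def doob_sum_def
        nbr_sum_def v)
qed

section \<open>Splitting the coordinates into two groups\<close>

definition vertex_append :: "doob_vertex \<Rightarrow> doob_vertex \<Rightarrow> doob_vertex" where
  "vertex_append u v = (fst u @ fst v, snd u @ snd v)"

lemma doob_sum_append:
  "doob_sum \<phi> (vertex_append u v) =
     doob_sum (\<lambda>w. \<phi> (vertex_append w v)) u + doob_sum (\<lambda>w. \<phi> (vertex_append u w)) v"
  by (simp add: doob_sum_def vertex_append_def nbr_sum_append not_K4_adj_self
      not_shrikhande_adj_self add_ac)

definition vertex_take :: "nat \<Rightarrow> nat \<Rightarrow> doob_vertex \<Rightarrow> doob_vertex" where
  "vertex_take m n v = (take m (fst v), take n (snd v))"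

definition vertex_drop :: "nat \<Rightarrow> nat \<Rightarrow> doob_vertex \<Rightarrow> doob_vertex" where
  "vertex_drop m n v = (drop m (fst v), drop n (snd v))"

lemma vertex_split:
  assumes "v \<in> doob_verts (m1 + m2) (n1 + n2)"
  obtains v1 v2 where "v1 \<in> doob_verts m1 n1" "v2 \<in> doob_verts m2 n2" "v = vertex_append v1 v2"
proof
  show "vertex_take m1 n1 v \<in> doob_verts m1 n1" "vertex_drop m1 n1 v \<in> doob_verts m2 n2"
    "v = vertex_append (vertex_take m1 n1 v) (vertex_drop m1 n1 v)"
    using assms
    by (auto simp: doob_verts_def vertex_take_def vertex_drop_def vertex_append_def)
qed

lemma vertex_take_append [simp]:
  "u \<in> doob_verts m n \<Longrightarrow> vertex_take m n (vertex_append u v) = u"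
  "u \<in> doob_verts m n \<Longrightarrow> vertex_drop m n (vertex_append u v) = v"
  by (auto simp: doob_verts_def vertex_take_def vertex_drop_def vertex_append_def)

section \<open>Arithmetic modulo 4 and the Shrikhande graph\<close>

lemma UNIV_4: "(UNIV :: 4 set) = {0, 1, 2, 3}"
  by (rule sym, rule card_subset_eq) simp_all

lemma shrikhande_nbrs: "{y. shrikhande_adj x y} = (\<lambda>c. x + c) ` shrikhande_conn"
  by (auto simp: shrikhande_adj_def image_iff) (metis add.commute diff_add_cancel)

lemma sum_shrikhande_nbrs: "(\<Sum>y | shrikhande_adj x y. \<phi> y) = (\<Sum>c\<in>shrikhande_conn. \<phi> (x + c))"
  by (simp add: shrikhande_nbrs sum.reindex)

lemma sum_K4_nbrs: "(\<Sum>y | K4_adj x y. \<phi> y) = (\<Sum>y\<in>UNIV - {x}. \<phi> y)"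
  by (rule sum.cong) (auto simp: K4_adj_def)

lemma sum_shrikhande_conn:
  "(\<Sum>c\<in>shrikhande_conn. \<phi> c) =
    \<phi> (0, 1) + (\<phi> (0, 3) + (\<phi> (1, 0) + (\<phi> (3, 0) + (\<phi> (1, 1) + \<phi> (3, 3)))))"
  by (simp add: shrikhande_conn_def)

lemma sum_UNIV_shift: "(\<Sum>y\<in>UNIV. \<phi> (x + y)) = (\<Sum>y\<in>UNIV. \<phi> (y :: 'a::{finite, ab_group_add}))"
  by (rule sum.reindex_bij_witness[of _ "\<lambda>y. y - x" "\<lambda>y. x + y"]) auto

lemma numeral_mod_4: "(4::4) = 0" "(5::4) = 1" "(6::4) = 2" "- (1::4) = 3" "- (2::4) = 2" "- (3::4) = 1"
  by simp_all

text \<open>The Shrikhande graph is strongly regular with parameters (16, 6, 2, 2), so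
  \<open>A^2 = 4 I + 2 J\<close>, J being the all-ones matrix.\<close>

lemma shrikhande_square:
  fixes G :: "4 \<times> 4 \<Rightarrow> real"
  shows "(\<Sum>y | shrikhande_adj x y. \<Sum>z | shrikhande_adj y z. G z) = 4 * G x + 2 * (\<Sum>z\<in>UNIV. G z)"
proof -
  have U: "(UNIV :: (4 \<times> 4) set) = {0,1,2,3} \<times> {0,1,2,3}"
    using UNIV_4 by (simp flip: UNIV_Times_UNIV)
  \<comment> \<open>By translation only sums of two connection elements matter: 0 arises six times,
    every other element twice.\<close>
  have "(\<Sum>c\<in>shrikhande_conn. \<Sum>d\<in>shrikhande_conn. H (c + d)) = 4 * H (0, 0) + 2 * (\<Sum>d\<in>UNIV. H d)"
    for H :: "4 \<times> 4 \<Rightarrow> real"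
  proof -
    have "(\<Sum>d\<in>UNIV. H d) = (\<Sum>a\<in>{0,1,2,3}. \<Sum>b\<in>{0,1,2,3}. H (a, b))"
      unfolding U by (simp only: sum.cartesian_product case_prod_eta)
    then show ?thesis by (simp add: sum_shrikhande_conn numeral_mod_4)
  qed
  from this[of "\<lambda>d. G (x + d)"] show ?thesis
    by (simp add: sum_shrikhande_nbrs add.assoc sum_UNIV_shift flip: zero_prod_def)
qed

lemma doob_sum_add: "doob_sum (\<lambda>u. \<phi> u + \<psi> u) v = doob_sum \<phi> v + doob_sum \<psi> v"
  by (simp add: doob_sum_def nbr_sum_def sum.distrib add_ac)

lemma doob_sum_sum: "doob_sum (\<lambda>u. \<Sum>i\<in>I. \<phi> i u) v = (\<Sum>i\<in>I. doob_sum (\<phi> i) v)"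
  by (simp add: doob_sum_def nbr_sum_def sum.distrib sum.swap[of _ I])

lemma doob_sum_mult: "doob_sum (\<lambda>u. c * \<phi> u) v = c * (doob_sum \<phi> v :: 'a::semiring_0)"
  by (simp add: doob_sum_def nbr_sum_def distrib_left sum_distrib_left)

lemma doob_sum_diff: "doob_sum (\<lambda>u. \<phi> u - \<psi> u) v = doob_sum \<phi> v - (doob_sum \<psi> v :: 'a::ab_group_add)"
  by (simp add: doob_sum_def nbr_sum_def sum_subtractf)

subsection \<open>Necessity\<close>

text \<open>g lives on all pairs of lists, hence the demand that it be nonzero at an actual
  vertex.\<close>

definition eigenfunction :: "nat \<Rightarrow> nat \<Rightarrow> real \<Rightarrow> (doob_vertex \<Rightarrow> real) \<Rightarrow> bool" where
  "eigenfunction m n \<mu> g \<longleftrightarrow>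
     (\<forall>v\<in>doob_verts m n. doob_sum g v = \<mu> * g v) \<and> (\<exists>v\<in>doob_verts m n. g v \<noteq> 0)"

lemma doob_sum_Cons_K4:
  "doob_sum g (xs, y # ys) =
     (\<Sum>z\<in>UNIV - {y}. g (xs, z # ys)) + doob_sum (\<lambda>u. g (fst u, y # snd u)) (xs, ys)"
  by (simp add: doob_sum_def nbr_sum_Cons not_K4_adj_self sum_K4_nbrs add_ac)

lemma doob_sum_Cons_shrikhande:
  "doob_sum g (x # xs, ys) =
     (\<Sum>z | shrikhande_adj x z. g (z # xs, ys)) + doob_sum (\<lambda>u. g (x # fst u, snd u)) (xs, ys)"
  by (simp add: doob_sum_def nbr_sum_Cons not_shrikhande_adj_self add_ac)

text \<open>Summing over the first K4 entry projects to the factor eigenvalue 3; if the projection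
  vanishes, every slice belongs to the factor eigenvalue -1.\<close>

lemma eigenfunction_drop_K4:
  assumes "eigenfunction m (Suc n) \<mu> g"
  shows "\<exists>h. eigenfunction m n (\<mu> - 3) h \<or> eigenfunction m n (\<mu> + 1) h"
proof -
  define G where "G y u = g (fst u, y # snd u)" for y and u :: doob_vertex
  have eq: "doob_sum (G y) u = (\<mu> + 1) * G y u - (\<Sum>z\<in>UNIV. G z u)"
    if "u \<in> doob_verts m n" for y u
  proof -
    have "(fst u, y # snd u) \<in> doob_verts m (Suc n)" using that by (auto simp: doob_verts_def)
    with assms have ev: "doob_sum g (fst u, y # snd u) = \<mu> * g (fst u, y # snd u)"
      unfolding eigenfunction_def by blast
    then have "(\<Sum>z\<in>UNIV - {y}. G z u) + doob_sum (G y) u = \<mu> * G y u"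
      using ev by (simp add: doob_sum_Cons_K4 G_def[abs_def])
    moreover have "(\<Sum>z\<in>UNIV. G z u) = G y u + (\<Sum>z\<in>UNIV - {y}. G z u)"
      by (simp add: sum.remove)
    ultimately show ?thesis by (simp add: algebra_simps)
  qed
  define s where "s u = (\<Sum>z\<in>UNIV. G z u)" for u
  have s: "doob_sum s u = (\<mu> - 3) * s u" if "u \<in> doob_verts m n" for u
  proof -
    have "doob_sum s u = (\<Sum>y\<in>UNIV. (\<mu> + 1) * G y u - s u)"
      unfolding s_def by (simp add: doob_sum_sum eq that)
    also have "\<dots> = (\<mu> + 1) * s u - 4 * s u"
      by (simp add: sum_subtractf s_def flip: sum_distrib_left)
    finally show ?thesis by (simp add: algebra_simps)
  qed
  show ?thesis
  proof (cases "\<exists>u\<in>doob_verts m n. s u \<noteq> 0")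
    case True
    then show ?thesis using s unfolding eigenfunction_def by blast
  next
    case False
    obtain v where v: "v \<in> doob_verts m (Suc n)" "g v \<noteq> 0"
      using assms by (auto simp: eigenfunction_def)
    then obtain xs y ys where "v = (xs, y # ys)" "(xs, ys) \<in> doob_verts m n"
      by (auto simp: doob_verts_def length_Suc_conv)
    then have "eigenfunction m n (\<mu> + 1) (G y)"
      using v eq False by (force simp: eigenfunction_def s_def G_def)
    then show ?thesis by blast
  qed
qed

text \<open>As for K4, with factor eigenvalue 6 for the sum over the entry. If that sum vanishes,
  the factor operator squares to 4, which leaves the eigenvalues 2 and -2.\<close>

lemma eigenfunction_drop_shrikhande:
  assumes "eigenfunction (Suc m) n \<mu> g"
  shows "\<exists>h. eigenfunction m n (\<mu> - 6) h \<or> eigenfunction m n (\<mu> - 2) h \<or> eigenfunction m n (\<mu> + 2) h"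
proof -
  define G where "G x u = g (x # fst u, snd u)" for x and u :: doob_vertex
  define B where "B x u = (\<Sum>z | shrikhande_adj x z. G z u)" for x u
  have eq: "doob_sum (G x) u = \<mu> * G x u - B x u" if "u \<in> doob_verts m n" for x u
  proof -
    have "(x # fst u, snd u) \<in> doob_verts (Suc m) n" using that by (auto simp: doob_verts_def)
    with assms have ev: "doob_sum g (x # fst u, snd u) = \<mu> * g (x # fst u, snd u)"
      unfolding eigenfunction_def by blast
    then have "B x u + doob_sum (G x) u = \<mu> * G x u"
      using ev by (simp add: doob_sum_Cons_shrikhande G_def[abs_def] B_def)
    then show ?thesis by simp
  qed
  define s where "s u = (\<Sum>z\<in>UNIV. G z u)" for u
  have BB: "(\<Sum>z | shrikhande_adj x z. B z u) = 4 * G x u + 2 * s u" for x u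
    unfolding B_def s_def by (rule shrikhande_square)
  have "(\<Sum>x\<in>UNIV. B x u) = 6 * s u" for u
  proof -
    have "(\<Sum>x\<in>UNIV. B x u) = (\<Sum>c\<in>shrikhande_conn. \<Sum>x\<in>UNIV. G (c + x) u)"
      unfolding B_def sum_shrikhande_nbrs by (subst sum.swap) (simp add: add.commute)
    also have "\<dots> = 6 * s u"
      unfolding s_def sum_UNIV_shift[of "\<lambda>z. G z u"] by (simp add: shrikhande_conn_def)
    finally show ?thesis .
  qed
  then have s: "doob_sum s u = (\<mu> - 6) * s u" if "u \<in> doob_verts m n" for u
    unfolding s_def
    by (simp add: doob_sum_sum eq that sum_subtractf algebra_simps sum_distrib_left)
  show ?thesis
  proof (cases "\<exists>u\<in>doob_verts m n. s u \<noteq> 0")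
    case True
    then show ?thesis using s unfolding eigenfunction_def by blast
  next
    case False
    have eqB: "doob_sum (B x) u = \<mu> * B x u - 4 * G x u" if "u \<in> doob_verts m n" for x u
    proof -
      have "doob_sum (B x) u = (\<Sum>z | shrikhande_adj x z. \<mu> * G z u - B z u)"
        unfolding B_def[of x] by (simp add: doob_sum_sum eq that)
      also have "\<dots> = \<mu> * B x u - 4 * G x u"
        using BB[of u x] False that by (simp add: sum_subtractf sum_distrib_left B_def[of x])
      finally show ?thesis .
    qed
    obtain v where v: "v \<in> doob_verts (Suc m) n" "g v \<noteq> 0"
      using assms by (auto simp: eigenfunction_def)
    then obtain x xs ys where x: "v = (x # xs, ys)" "(xs, ys) \<in> doob_verts m n"
      by (auto simp: doob_verts_def length_Suc_conv)
    \<comment> \<open>These are the projections to factor eigenvalues 2 and -2, up to scaling; their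
      difference is \<open>4 * G x\<close>, so they cannot both vanish where \<open>G x\<close> does
      not.\<close>
    have "doob_sum (\<lambda>u. B x u + 2 * G x u) u = (\<mu> - 2) * (B x u + 2 * G x u)"
      "doob_sum (\<lambda>u. B x u - 2 * G x u) u = (\<mu> + 2) * (B x u - 2 * G x u)"
      if "u \<in> doob_verts m n" for u
      unfolding doob_sum_add doob_sum_diff doob_sum_mult using that
      by (simp_all add: eq eqB algebra_simps)
    moreover have "B x (xs, ys) + 2 * G x (xs, ys) \<noteq> 0 \<or> B x (xs, ys) - 2 * G x (xs, ys) \<noteq> 0"
      using v(2) x(1) by (auto simp: G_def)
    ultimately have "eigenfunction m n (\<mu> - 2) (\<lambda>u. B x u + 2 * G x u) \<or>
        eigenfunction m n (\<mu> + 2) (\<lambda>u. B x u - 2 * G x u)"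
      using x(2) unfolding eigenfunction_def by blast
    then show ?thesis by blast
  qed
qed

text \<open>Modulo 4 the eigenvalues 3 and -1 of K4 agree, and so do 6, 2, -2; each coordinate
  therefore contributes a fixed residue.\<close>

lemma eigenvalue_mod_4:
  "eigenfunction m n \<mu> g \<Longrightarrow> \<exists>z::int. \<mu> = of_int (2 * int m - int n + 4 * z)"
proof (induction m arbitrary: \<mu> g)
  case 0
  then show ?case
  proof (induction n arbitrary: \<mu> g)
    case 0
    then have "\<mu> = 0" by (auto simp: eigenfunction_def doob_verts_def doob_sum_def)
    then show ?case by (intro exI[of _ 0]) simp
  next
    case (Suc n)
    from eigenfunction_drop_K4[OF Suc.prems]
    obtain z :: int where "\<mu> - 3 = of_int (4 * z - int n) \<or> \<mu> + 1 = of_int (4 * z - int n)"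
      using Suc.IH by fastforce
    then show ?case
    proof
      assume "\<mu> - 3 = of_int (4 * z - int n)"
      then show ?thesis by (intro exI[of _ "z + 1"]) simp
    next
      assume "\<mu> + 1 = of_int (4 * z - int n)"
      then show ?thesis by (intro exI[of _ z]) simp
    qed
  qed
next
  case (Suc m)
  let ?f = "\<lambda>z::int. of_int (2 * int m - int n + 4 * z) :: real"
  from eigenfunction_drop_shrikhande[OF Suc.prems]
  obtain z where "\<mu> - 6 = ?f z \<or> \<mu> - 2 = ?f z \<or> \<mu> + 2 = ?f z"
    using Suc.IH by fast
  then consider "\<mu> - 6 = ?f z" | "\<mu> - 2 = ?f z" | "\<mu> + 2 = ?f z" by blast
  then show ?case
  proof cases
    case 1
    then show ?thesis by (intro exI[of _ "z + 1"]) simp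
  next
    case 2
    then show ?thesis by (intro exI[of _ z]) simp
  next
    case 3
    then show ?thesis by (intro exI[of _ "z - 1"]) simp
  qed
qed

section \<open>Codes as solutions of a linear equation, and double counting\<close>

lemma card_ball_inter:
  assumes "v \<in> doob_verts m n"
  shows "card (C \<inter> unit_ball (doob_verts m n) doob_adj v) =
    of_bool (v \<in> C) + doob_sum (\<lambda>u. of_bool (u \<in> C)) v"
proof -
  have "finite (unit_ball (doob_verts m n) doob_adj v)"
    using finite_doob_verts by (rule finite_subset[rotated]) (auto simp: unit_ball_def)
  then have "card (C \<inter> unit_ball (doob_verts m n) doob_adj v) =
      (\<Sum>u\<in>unit_ball (doob_verts m n) doob_adj v. of_bool (u \<in> C))"
    by (simp add: sum.If_cases of_bool_def Int_commute)
  also have "\<dots> = of_bool (v \<in> C) + doob_sum (\<lambda>u. of_bool (u \<in> C)) v"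
    by (rule sum_unit_ball[OF assms])
  finally show ?thesis .
qed

lemma of_nat_doob_sum: "of_nat (doob_sum \<phi> v) = doob_sum (\<lambda>u. of_nat (\<phi> u)) v"
  by (simp add: doob_sum_def nbr_sum_def)

lemma perfect_code_imp_cong:
  assumes C: "multifold_perfect_code (doob_verts m n) doob_adj c C" and "c \<noteq> 6 * m + 3 * n + 1"
  shows "[2 * m + n = 1] (mod 4)"
proof -
  let ?V = "doob_verts m n" and ?d = "real (6 * m + 3 * n + 1)"
  \<comment> \<open>\<open>real c / ?d\<close> is the density of the code; subtracting it turns
    \<open>(I + A) 1_C = c\<close> into \<open>(I + A) g = 0\<close>.\<close>
  define g where "g v = of_bool (v \<in> C) - real c / ?d" for v
  have const: "of_bool True + doob_sum (\<lambda>u. 1::nat) v = 6 * m + 3 * n + 1" if "v \<in> ?V" for v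
    using card_ball_inter[OF that, of UNIV] card_doob_unit_ball[OF that] by simp
  have "doob_sum g v = (-1) * g v" if v: "v \<in> ?V" for v
  proof -
    have "of_bool (v \<in> C) + doob_sum (\<lambda>u. of_bool (u \<in> C)) v = c"
      using C v unfolding multifold_perfect_code_def card_ball_inter[OF v, symmetric] by simp
    then have "real (of_bool (v \<in> C)) + real (doob_sum (\<lambda>u. of_bool (u \<in> C)) v) = real c"
      by linarith
    then have 1: "of_bool (v \<in> C) + doob_sum (\<lambda>u. of_bool (u \<in> C)) v = real c"
      by (simp add: of_nat_doob_sum)
    have "real (doob_sum (\<lambda>u. 1::nat) v) = ?d - 1" using const[OF v] by (metis add_diff_cancel_left' of_bool_eq(2) of_nat_1 of_nat_add)
    then have "doob_sum (\<lambda>u. 1::real) v = ?d - 1" by (simp add: of_nat_doob_sum)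
    then have "doob_sum (\<lambda>u. real c / ?d * 1) v = real c / ?d * (?d - 1)"
      unfolding doob_sum_mult by simp
    also have "\<dots> = real c - real c / ?d" by (simp add: field_simps)
    finally show ?thesis using 1 by (simp add: g_def[abs_def] doob_sum_diff)
  qed
  \<comment> \<open>At a code vertex g equals \<open>1 - c / ?d\<close>, which vanishes only for a
    code as large as the whole ball.\<close>
  moreover have "\<exists>v\<in>?V. g v \<noteq> 0"
  proof -
    obtain v where "v \<in> C" "v \<in> ?V" using C by (auto simp: multifold_perfect_code_def)
    moreover have "real c \<noteq> ?d" using assms(2) by (metis of_nat_eq_iff)
    ultimately show ?thesis by (intro bexI[of _ v]) (auto simp: g_def field_simps)
  qed
  ultimately have "eigenfunction m n (-1) g" by (auto simp: eigenfunction_def)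
  then obtain z :: int where "(-1::real) = of_int (2 * int m - int n + 4 * z)"
    using eigenvalue_mod_4 by blast
  then have "- 1 = 2 * int m - int n + 4 * z" by (metis of_int_1 of_int_eq_iff of_int_minus)
  \<comment> \<open>Modulo 4, n is 2m + 1, hence 2m + n is 4m + 1.\<close>
  then have "(2 * m + n) mod 4 = 1" by presburger
  then show ?thesis by (simp add: cong_def)
qed

lemma cart_power_adj_sym:
  assumes "\<And>x y. A x y \<Longrightarrow> A y x" and "cart_power_adj A xs ys"
  shows "cart_power_adj A ys xs"
proof -
  from assms(2) obtain i where "length xs = length ys" "i < length xs" "A (xs ! i) (ys ! i)"
    "\<forall>j<length xs. j \<noteq> i \<longrightarrow> xs ! j = ys ! j"
    by (auto simp: cart_power_adj_def)
  then show ?thesis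
    unfolding cart_power_adj_def using assms(1) by (intro conjI exI[of _ i]) auto
qed

lemma doob_adj_sym: "doob_adj u v \<Longrightarrow> doob_adj v u"
  using cart_power_adj_sym[of shrikhande_adj "fst u" "fst v"] cart_power_adj_sym[of K4_adj "snd u" "snd v"]
  unfolding doob_adj_def by (metis K4_adj_def shrikhande_adj_sym)

lemma card_doob_verts: "card (doob_verts m n) = 2 ^ (4 * m + 2 * n)"
proof -
  have "doob_verts m n = {xs. length xs = m} \<times> {ys. length ys = n}"
    by (auto simp: doob_verts_def)
  moreover have "card {xs :: (4 \<times> 4) list. length xs = m} = 16 ^ m" 
    using card_lists_length_eq[of "UNIV :: (4\<times>4) set" m] by simp
  moreover have "card {xs :: 4 list. length xs = n} = 4 ^ n" 
    using card_lists_length_eq[of "UNIV :: 4 set" n] by simp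
  ultimately show ?thesis
    by (simp add: card_cartesian_product power_add power_mult)
qed

text \<open>Pairs of a vertex v and a code vertex in the ball of v are counted in two ways;
  adjacency is symmetric.\<close>

lemma perfect_code_card:
  assumes C: "multifold_perfect_code (doob_verts m n) doob_adj c C"
  shows "2 ^ (4 * m + 2 * n) * c = card C * (6 * m + 3 * n + 1)"
proof -
  let ?V = "doob_verts m n" and ?B = "unit_ball (doob_verts m n) doob_adj"
  have CV: "C \<subseteq> ?V" and fC: "finite C"
    using C finite_subset[OF _ finite_doob_verts] by (auto simp: multifold_perfect_code_def)
  have "2 ^ (4 * m + 2 * n) * c = (\<Sum>v\<in>?V. card {u \<in> C. u \<in> ?B v})"
    using C by (simp add: multifold_perfect_code_def card_doob_verts Int_def)
  also have "\<dots> = (\<Sum>u\<in>C. card {v \<in> ?V. u \<in> ?B v})"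
    using finite_doob_verts fC by (intro sum_multicount_gen) simp_all
  also have "\<dots> = (\<Sum>u\<in>C. card (?B u))"
  proof (rule sum.cong)
    fix u assume "u \<in> C"
    then have "{v \<in> ?V. u \<in> ?B v} = ?B u"
      using CV by (auto simp: unit_ball_def intro: doob_adj_sym)
    then show "card {v \<in> ?V. u \<in> ?B v} = card (?B u)" by simp
  qed simp
  also have "\<dots> = (\<Sum>u\<in>C. 6 * m + 3 * n + 1)"
    using CV card_doob_unit_ball by (intro sum.cong) auto
  also have "\<dots> = card C * (6 * m + 3 * n + 1)" by simp
  finally show ?thesis .
qed

text \<open>The number of vertices is a power of 2, hence coprime to \<alpha>, so double counting
  forces \<alpha> to divide c. The size of a ball bounds c from above.\<close>

lemma perfect_code_multiplicity:
  assumes C: "multifold_perfect_code (doob_verts m n) doob_adj c C"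
    and "odd \<alpha>" "6 * m + 3 * n + 1 = \<alpha> * 2 ^ k" "c > 0"
  shows "\<exists>l\<in>{1..2 ^ k}. c = \<alpha> * l"
proof -
  have "\<alpha> dvd 2 ^ (4 * m + 2 * n) * c"
    unfolding perfect_code_card[OF C] assms(3) by simp
  moreover have "coprime \<alpha> (2 ^ (4 * m + 2 * n))"
    using assms(2) by (simp add: coprime_power_right_iff)
  ultimately have "\<alpha> dvd c" by (simp add: coprime_dvd_mult_right_iff)
  then obtain l where l: "c = \<alpha> * l" by blast
  obtain v where v: "v \<in> doob_verts m n" using doob_verts_nonempty by blast
  have "c \<le> card (unit_ball (doob_verts m n) doob_adj v)"
  proof -
    have "finite (unit_ball (doob_verts m n) doob_adj v)"
      using finite_doob_verts by (rule finite_subset[rotated]) (auto simp: unit_ball_def)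
    then show ?thesis
      using C v card_mono[of "unit_ball (doob_verts m n) doob_adj v"]
      by (auto simp: multifold_perfect_code_def)
  qed
  then have "\<alpha> * l \<le> \<alpha> * 2 ^ k"
    using card_doob_unit_ball[OF v] assms(3) l by simp
  then have "l \<le> 2 ^ k" using assms(2) by (cases "\<alpha> = 0") auto
  moreover have "l \<ge> 1" using assms(4) l by (cases l) auto
  ultimately show ?thesis using l by auto
qed

subsection \<open>Colourings with prescribed increments\<close>

text \<open>Pairs of colours are stored as integers with a low digit in base \<open>w0\<close>, so
  that colour sets can grow in a recursion without a change of type.\<close>

lemma mixed_radix_cong:
  fixes r q c :: int
  assumes "0 \<le> r" "r < w0"
  shows "[r + w0 * q = c] (mod w0 * w) \<longleftrightarrow> r = c mod w0 \<and> [q = c div w0] (mod w)"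
proof -
  have w0: "w0 > 0" using assms by simp
  define c0 c1 where "c0 = c mod w0" and "c1 = c div w0"
  have c: "c = c0 + w0 * c1" by (simp add: c0_def c1_def)
  have scale: "[w0 * q = w0 * c1] (mod w0 * w) \<longleftrightarrow> [q = c1] (mod w)"
    using w0 by (simp add: cong_iff_dvd_diff flip: right_diff_distrib)
  have "[r + w0 * q = c] (mod w0 * w) \<longleftrightarrow> r = c0 \<and> [q = c1] (mod w)"
  proof (cases "r = c0")
    case True
    then show ?thesis by (simp add: c cong_add_lcancel scale)
  next
    case False
    have "\<not> [r + w0 * q = c] (mod w0)"
      using False assms by (simp add: cong_def c0_def)
    then show ?thesis using False cong_dvd_modulus[of "r + w0 * q" c "w0 * w" w0] by auto
  qed
  then show ?thesis by (simp add: c0_def c1_def)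
qed

text \<open>
  The colouring \<open>(S, R)\<close>, with \<open>R\<close> read modulo \<open>w\<close>: around \<open>v\<close>, each colour whose first component is
  \<open>S v + g\<close> occurs \<open>\<iota> g\<close> times, whatever its second component.
\<close>

definition has_increments :: "nat \<Rightarrow> nat \<Rightarrow> nat \<Rightarrow> ('g::ab_group_add \<Rightarrow> nat) \<Rightarrow> bool" where
  "has_increments w m n \<iota> \<longleftrightarrow> (\<exists>S (R :: doob_vertex \<Rightarrow> int). \<forall>v\<in>doob_verts m n. \<forall>x c.
     doob_sum (\<lambda>u. of_bool (S u = x \<and> [R u = c] (mod int w))) v = \<iota> (x - S v))"

text \<open>Add the colourings of the two factors: a move in one factor sees the other as a constant
  shift, which increments ignore.\<close>

lemma has_increments_append:
  assumes "has_increments w m1 n1 \<iota>1" "has_increments w m2 n2 \<iota>2"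
  shows "has_increments w (m1 + m2) (n1 + n2) (\<lambda>x. \<iota>1 x + \<iota>2 x)"
proof -
  from assms(1) obtain S1 and R1 :: "doob_vertex \<Rightarrow> int" where 1: "\<And>v x c. v \<in> doob_verts m1 n1 \<Longrightarrow>
      doob_sum (\<lambda>u. of_bool (S1 u = x \<and> [R1 u = c] (mod int w))) v = \<iota>1 (x - S1 v)"
    unfolding has_increments_def by blast
  from assms(2) obtain S2 and R2 :: "doob_vertex \<Rightarrow> int" where 2: "\<And>v x c. v \<in> doob_verts m2 n2 \<Longrightarrow>
      doob_sum (\<lambda>u. of_bool (S2 u = x \<and> [R2 u = c] (mod int w))) v = \<iota>2 (x - S2 v)"
    unfolding has_increments_def by blast
  define S where "S v = S1 (vertex_take m1 n1 v) + S2 (vertex_drop m1 n1 v)" for v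
  define R where "R v = R1 (vertex_take m1 n1 v) + R2 (vertex_drop m1 n1 v)" for v
  have "doob_sum (\<lambda>u. of_bool (S u = x \<and> [R u = c] (mod int w))) v = \<iota>1 (x - S v) + \<iota>2 (x - S v)"
    if v: "v \<in> doob_verts (m1 + m2) (n1 + n2)" for v x c
  proof -
    obtain v1 v2 where v1: "v1 \<in> doob_verts m1 n1" and v2: "v2 \<in> doob_verts m2 n2"
      and v12: "v = vertex_append v1 v2"
      using v by (rule vertex_split)
    have A: "doob_sum (\<lambda>u. of_bool (S (vertex_append u v2) = x \<and> [R (vertex_append u v2) = c] (mod int w))) v1
        = doob_sum (\<lambda>u. of_bool (S1 u = x - S2 v2 \<and> [R1 u = c - R2 v2] (mod int w))) v1"
      by (rule doob_sum_cong[OF v1])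
        (auto simp: S_def R_def algebra_simps cong_iff_dvd_diff intro!: arg_cong[of _ _ of_bool])
    have B: "doob_sum (\<lambda>u. of_bool (S (vertex_append v1 u) = x \<and> [R (vertex_append v1 u) = c] (mod int w))) v2
        = doob_sum (\<lambda>u. of_bool (S2 u = x - S1 v1 \<and> [R2 u = c - R1 v1] (mod int w))) v2"
      by (rule doob_sum_cong[OF v2])
        (use v1 in \<open>auto simp: S_def R_def algebra_simps cong_iff_dvd_diff intro!: arg_cong[of _ _ of_bool]\<close>)
    have "S (vertex_append v1 v2) = S1 v1 + S2 v2" using v1 by (simp add: S_def)
    then show ?thesis
      unfolding v12 doob_sum_append A B 1[OF v1] 2[OF v2] by (simp add: algebra_simps)
  qed
  then show ?thesis unfolding has_increments_def by blast
qed

lemma has_increments_empty: "has_increments w 0 0 (\<lambda>_. 0)"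
  by (auto simp: has_increments_def doob_verts_def doob_sum_def)

lemma has_increments_sum:
  assumes "finite I" "\<And>j. j \<in> I \<Longrightarrow> has_increments w (m j) (n j) (\<iota> j)"
  shows "has_increments w (\<Sum>j\<in>I. m j) (\<Sum>j\<in>I. n j) (\<lambda>x. \<Sum>j\<in>I. \<iota> j x)"
  using assms
proof (induction I rule: finite_induct)
  case empty
  then show ?case by (simp add: has_increments_empty)
next
  case (insert j I)
  then show ?case
    using has_increments_append[of w "m j" "n j" "\<iota> j" "sum m I" "sum n I" "\<lambda>x. \<Sum>j\<in>I. \<iota> j x"]
    by simp
qed

lemma has_increments_pushforward:
  fixes h :: "'g::{finite, ab_group_add} \<Rightarrow> 'h::ab_group_add"
  assumes "has_increments w m n \<iota>" and h: "\<And>a b. h (a - b) = h a - h b"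
  shows "has_increments w m n (\<lambda>x. \<Sum>e | h e = x. \<iota> e)"
proof -
  from assms(1) obtain S and R :: "doob_vertex \<Rightarrow> int" where 1: "\<And>v x c. v \<in> doob_verts m n \<Longrightarrow>
      doob_sum (\<lambda>u. of_bool (S u = x \<and> [R u = c] (mod int w))) v = \<iota> (x - S v)"
    unfolding has_increments_def by blast
  have "doob_sum (\<lambda>u. of_bool (h (S u) = x \<and> [R u = c] (mod int w))) v = (\<Sum>e | h e = x - h (S v). \<iota> e)"
    if v: "v \<in> doob_verts m n" for v x c
  proof -
    have "doob_sum (\<lambda>u. of_bool (h (S u) = x \<and> [R u = c] (mod int w))) v =
        doob_sum (\<lambda>u. \<Sum>e | h e = x. of_bool (S u = e \<and> [R u = c] (mod int w)) :: nat) v"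
    proof (rule doob_sum_cong[OF v])
      fix u
      show "of_bool (h (S u) = x \<and> [R u = c] (mod int w)) =
          (\<Sum>e | h e = x. of_bool (S u = e \<and> [R u = c] (mod int w)) :: nat)"
        by (cases "[R u = c] (mod int w)") (simp_all add: of_bool_def)
    qed
    also have "\<dots> = (\<Sum>e | h e = x. \<iota> (e - S v))"
      unfolding doob_sum_sum 1[OF v] ..
    also have "\<dots> = (\<Sum>e | h e = x - h (S v). \<iota> e)"
    proof (rule sum.reindex_bij_witness[of _ "\<lambda>e. e + S v" "\<lambda>e. e - S v"])
      fix e assume "e \<in> {e. h e = x - h (S v)}"
      then show "e + S v \<in> {e. h e = x}" using h[of "e + S v" "S v"] by simp
    qed (auto simp: h)
    finally show ?thesis .
  qed
  then show ?thesis unfolding has_increments_def by (intro exI[of _ "\<lambda>u. h (S u)"] exI[of _ R]) blast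
qed

text \<open>Increments that depend only on \<sigma> allow the rest of the first component to move
  into the second: \<kappa> numbers each fibre of \<sigma>, and this number becomes the low digit of
  the new second component.\<close>

lemma has_increments_regroup:
  fixes \<sigma> :: "'g::ab_group_add \<Rightarrow> 'h::ab_group_add" and \<kappa> :: "'g \<Rightarrow> int"
  assumes "has_increments w m n (\<lambda>g. \<iota> (\<sigma> g))" and \<sigma>: "\<And>a b. \<sigma> (a - b) = \<sigma> a - \<sigma> b"
    and "w0 > 0" and \<kappa>: "\<And>x c. \<exists>!g. \<sigma> g = x \<and> [\<kappa> g = c] (mod int w0)"
  shows "has_increments (w0 * w) m n \<iota>"
proof -
  from assms(1) obtain S and R :: "doob_vertex \<Rightarrow> int" where 1: "\<And>v x c. v \<in> doob_verts m n \<Longrightarrow>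
      doob_sum (\<lambda>u. of_bool (S u = x \<and> [R u = c] (mod int w))) v = \<iota> (\<sigma> (x - S v))"
    unfolding has_increments_def by blast
  define R' where "R' u = \<kappa> (S u) mod int w0 + int w0 * R u" for u
  have "doob_sum (\<lambda>u. of_bool (\<sigma> (S u) = x \<and> [R' u = c] (mod int (w0 * w)))) v = \<iota> (x - \<sigma> (S v))"
    if v: "v \<in> doob_verts m n" for v x c
  proof -
    obtain g where g: "\<And>e. \<sigma> e = x \<and> [\<kappa> e = c] (mod int w0) \<longleftrightarrow> e = g"
      using \<kappa>[of x c] by metis
    have R': "[R' u = c] (mod int (w0 * w)) \<longleftrightarrow>
        [\<kappa> (S u) = c] (mod int w0) \<and> [R u = c div int w0] (mod int w)" for u
      unfolding R'_def of_nat_mult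
      by (subst mixed_radix_cong) (use assms(3) in \<open>auto simp: cong_def\<close>)
    have "(\<lambda>u. of_bool (\<sigma> (S u) = x \<and> [R' u = c] (mod int (w0 * w))) :: nat) =
        (\<lambda>u. of_bool (S u = g \<and> [R u = c div int w0] (mod int w)))"
      unfolding R' by (intro ext arg_cong[of _ _ of_bool]) (use g in blast)
    then show ?thesis using 1[OF v, of g] g[of g] by (simp add: \<sigma>)
  qed
  then show ?thesis unfolding has_increments_def by (intro exI[of _ "\<lambda>u. \<sigma> (S u)"] exI[of _ R']) blast
qed

text \<open>A single coordinate coloured by its entry; modulo 1 the second component is trivial and
  is taken to be 0.\<close>

lemma has_increments_shrikhande:
  fixes f :: "4 \<times> 4 \<Rightarrow> 'g::ab_group_add"
  assumes "\<And>z x. (\<Sum>c\<in>shrikhande_conn. of_bool (f (z + c) = x)) = \<iota> (x - f z)"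
  shows "has_increments 1 1 0 \<iota>"
proof -
  have "doob_sum (\<lambda>u. of_bool (f (hd (fst u)) = x \<and> [0 = c] (mod int 1))) v = \<iota> (x - f (hd (fst v)))"
    if v: "v \<in> doob_verts 1 0" for v x c
  proof -
    obtain z where z: "v = ([z], [])" using v by (auto simp: doob_verts_def length_Suc_conv)
    have "doob_sum \<phi> v = (\<Sum>c\<in>shrikhande_conn. \<phi> ([z + c], []))" for \<phi> :: "doob_vertex \<Rightarrow> nat"
      unfolding z doob_sum_Cons_shrikhande sum_shrikhande_nbrs by (simp add: doob_sum_def)
    then show ?thesis by (simp only: z flip: assms) (simp add: cong_def)
  qed
  then show ?thesis unfolding has_increments_def
    by (intro exI[of _ "\<lambda>u. f (hd (fst u))"] exI[of _ "\<lambda>_. 0"]) blast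
qed

lemma has_increments_K4:
  fixes f :: "4 \<Rightarrow> 'g::ab_group_add"
  assumes "\<And>y x. (\<Sum>z\<in>UNIV - {y}. of_bool (f z = x)) = \<iota> (x - f y)"
  shows "has_increments 1 0 1 \<iota>"
proof -
  have "doob_sum (\<lambda>u. of_bool (f (hd (snd u)) = x \<and> [0 = c] (mod int 1))) v = \<iota> (x - f (hd (snd v)))"
    if v: "v \<in> doob_verts 0 1" for v x c
  proof -
    obtain y where y: "v = ([], [y])" using v by (auto simp: doob_verts_def length_Suc_conv)
    have "doob_sum \<phi> v = (\<Sum>z\<in>UNIV - {y}. \<phi> ([], [z]))" for \<phi> :: "doob_vertex \<Rightarrow> nat"
      unfolding y doob_sum_Cons_K4 by (simp add: doob_sum_def)
    then show ?thesis by (simp only: y flip: assms) (simp add: cong_def)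
  qed
  then show ?thesis unfolding has_increments_def
    by (intro exI[of _ "\<lambda>u. f (hd (snd u))"] exI[of _ "\<lambda>_. 0"]) blast
qed

text \<open>For \<alpha> > 0 the colour classes partition the vertices into K codes, each
  \<alpha>-fold 1-perfect.\<close>

definition balanced_colouring :: "nat \<Rightarrow> nat \<Rightarrow> nat \<Rightarrow> nat \<Rightarrow> bool" where
  "balanced_colouring m n \<alpha> K \<longleftrightarrow> (\<exists>F :: doob_vertex \<Rightarrow> int. \<forall>v\<in>doob_verts m n. \<forall>c.
     of_bool ([F v = c] (mod int K)) + doob_sum (\<lambda>u. of_bool ([F u = c] (mod int K))) v = \<alpha>)"

lemma balanced_colouring_trivial: "balanced_colouring m n (6 * m + 3 * n + 1) 1"
  unfolding balanced_colouring_def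
proof (intro exI[of _ "\<lambda>_. 0"] ballI allI)
  fix v c assume v: "v \<in> doob_verts m n"
  have "of_bool True + doob_sum (\<lambda>u. of_bool True) v = 6 * m + 3 * n + (1::nat)"
    using card_ball_inter[OF v, of UNIV] card_doob_unit_ball[OF v] by simp
  then show "of_bool ([0 = c] (mod int 1)) + doob_sum (\<lambda>u. of_bool ([0 = c] (mod int 1))) v = 6 * m + 3 * n + (1::nat)"
    by (simp add: cong_def)
qed

text \<open>The vertex itself counts as increment 0, so the last hypothesis makes all increments
  equally frequent in a ball; \<kappa> numbers the group elements.\<close>

lemma balanced_colouring_of_increments:
  fixes \<kappa> :: "'g::ab_group_add \<Rightarrow> int" and \<iota> :: "'g \<Rightarrow> nat"
  assumes "has_increments 1 m n \<iota>" "\<And>c. \<exists>!g. [\<kappa> g = c] (mod int K)"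
    and \<iota>: "\<And>x. of_bool (x = 0) + \<iota> x = \<alpha>"
  shows "balanced_colouring m n \<alpha> K"
proof -
  from assms(1) obtain S :: "doob_vertex \<Rightarrow> 'g" and R :: "doob_vertex \<Rightarrow> int" where 1: "\<And>v x. v \<in> doob_verts m n \<Longrightarrow>
      doob_sum (\<lambda>u. of_bool (S u = x)) v = \<iota> (x - S v)"
    unfolding has_increments_def by (auto simp: cong_def)
  show ?thesis
    unfolding balanced_colouring_def
  proof (intro exI[of _ "\<lambda>u. \<kappa> (S u)"] ballI allI)
    fix v c assume v: "v \<in> doob_verts m n"
    obtain g where g: "\<And>e. [\<kappa> e = c] (mod int K) \<longleftrightarrow> e = g"
      using assms(2)[of c] by metis
    show "of_bool ([\<kappa> (S v) = c] (mod int K)) + doob_sum (\<lambda>u. of_bool ([\<kappa> (S u) = c] (mod int K))) v = \<alpha>"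
      unfolding g using 1[OF v, of g] \<iota>[of "g - S v"] by (cases "S v = g") auto
  qed
qed

text \<open>For w > 0, counting neighbours gives \<open>3 * w * \<alpha> = 6 * m + 3 * n\<close>, so
  the coordinates have total weight \<open>2 * m + n = w * \<alpha>\<close>.\<close>

abbreviation latin :: "nat \<Rightarrow> nat \<Rightarrow> nat \<Rightarrow> nat \<Rightarrow> bool" where
  "latin w m n \<alpha> \<equiv> has_increments w m n (\<lambda>x :: 2 \<times> 2. if x = 0 then 0 else \<alpha>)"

lemma UNIV_2: "(UNIV :: 2 set) = {0, 1}"
  by (rule sym, rule card_subset_eq) simp_all

definition digit :: "2 \<Rightarrow> int" where "digit x = (if x = 0 then 0 else 1)"

lemma digit_code: "\<exists>!x. [digit x = c] (mod 2)"
proof -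
  have "[digit x = c] (mod 2) \<longleftrightarrow> x = (if even c then 0 else 1)" for x
  proof -
    have "x \<in> {0, 1}" using UNIV_2 by blast
    then show ?thesis by (auto simp: digit_def cong_def mod_2_eq_odd)
  qed
  then show ?thesis by simp
qed

lemma code_pair:
  fixes \<kappa>1 :: "'a \<Rightarrow> int" and \<kappa>2 :: "'b \<Rightarrow> int"
  assumes "\<And>c. \<exists>!x. [\<kappa>1 x = c] (mod int w1)" "\<And>c. \<exists>!x. [\<kappa>2 x = c] (mod int w2)" "w1 > 0"
  shows "\<exists>!x. [\<kappa>1 (fst x) mod int w1 + int w1 * \<kappa>2 (snd x) = c] (mod int (w1 * w2))"
proof -
  have eq: "[\<kappa>1 (fst x) mod int w1 + int w1 * \<kappa>2 (snd x) = c] (mod int (w1 * w2)) \<longleftrightarrow>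
      [\<kappa>1 (fst x) = c] (mod int w1) \<and> [\<kappa>2 (snd x) = c div int w1] (mod int w2)" for x
    unfolding of_nat_mult
    by (subst mixed_radix_cong) (use assms(3) in \<open>auto simp: cong_def\<close>)
  obtain a where a: "\<And>x. [\<kappa>1 x = c] (mod int w1) \<longleftrightarrow> x = a" using assms(1)[of c] by metis
  obtain b where b: "\<And>x. [\<kappa>2 x = c div int w1] (mod int w2) \<longleftrightarrow> x = b"
    using assms(2)[of "c div int w1"] by metis
  show ?thesis unfolding eq a b by (auto simp: prod_eq_iff)
qed

definition bits2 :: "2 \<times> 2 \<Rightarrow> int" where "bits2 x = digit (fst x) mod 2 + 2 * digit (snd x)"

lemma bits2_code: "\<exists>!x. [bits2 x = c] (mod int 4)"
  using code_pair[of digit 2 digit 2 c] digit_code by (simp add: bits2_def)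

definition bits3 :: "2 \<times> 2 \<times> 2 \<Rightarrow> int" where "bits3 x = digit (fst x) mod 2 + 2 * bits2 (snd x)"

lemma bits3_code: "\<exists>!x. [bits3 x = c] (mod int 8)"
  using code_pair[of digit 2 bits2 4 c] digit_code bits2_code by (simp add: bits3_def)

text \<open>The new colour is the pair of \<open>S v1\<close> and \<open>R v1 + F v2\<close>.
  Colours with another first component arise only by moving in the Latin part, \<alpha> times each;
  those with the same one arise only from v itself and moves in the other part, where F is
  balanced.\<close>

lemma balanced_colouring_step:
  assumes "latin w m1 n1 \<alpha>" "balanced_colouring m2 n2 \<alpha> w"
  shows "balanced_colouring (m1 + m2) (n1 + n2) \<alpha> (4 * w)"
proof -
  from assms(1) obtain S :: "doob_vertex \<Rightarrow> 2 \<times> 2" and R :: "doob_vertex \<Rightarrow> int"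
    where 1: "\<And>v x c. v \<in> doob_verts m1 n1 \<Longrightarrow>
      doob_sum (\<lambda>u. of_bool (S u = x \<and> [R u = c] (mod int w))) v = (if x - S v = 0 then 0 else \<alpha>)"
    unfolding has_increments_def by blast
  from assms(2) obtain F where 2: "\<And>v c. v \<in> doob_verts m2 n2 \<Longrightarrow>
      of_bool ([F v = c] (mod int w)) + doob_sum (\<lambda>u. of_bool ([F u = c] (mod int w))) v = \<alpha>"
    unfolding balanced_colouring_def by blast
  let ?t = "vertex_take m1 n1" and ?d = "vertex_drop m1 n1"
  define F' where "F' v = bits2 (S (?t v)) mod 4 + 4 * (R (?t v) + F (?d v))" for v
  show ?thesis
    unfolding balanced_colouring_def
  proof (intro exI[of _ F'] ballI allI)
    fix v c assume v: "v \<in> doob_verts (m1 + m2) (n1 + n2)"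
    obtain v1 v2 where v1: "v1 \<in> doob_verts m1 n1" and v2: "v2 \<in> doob_verts m2 n2"
      and v12: "v = vertex_append v1 v2"
      using v by (rule vertex_split)
    obtain g where g: "\<And>e. [bits2 e = c] (mod int 4) \<longleftrightarrow> e = g" using bits2_code[of c] by metis
    define q where "q = c div 4"
    have F': "[F' u = c] (mod int (4 * w)) \<longleftrightarrow> S (?t u) = g \<and> [R (?t u) + F (?d u) = q] (mod int w)" for u
    proof -
      have "[F' u = c] (mod int (4 * w)) \<longleftrightarrow> [bits2 (S (?t u)) = c] (mod int 4) \<and> [R (?t u) + F (?d u) = q] (mod int w)"
        unfolding F'_def of_nat_mult q_def
        by (subst of_nat_numeral, subst mixed_radix_cong) (auto simp: cong_def)
      then show ?thesis by (simp only: g)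
    qed
    have shift: "[a + b = q] (mod int w) \<longleftrightarrow> [a = q - b] (mod int w)"
      "[a + b = q] (mod int w) \<longleftrightarrow> [b = q - a] (mod int w)" for a b
      by (simp_all add: cong_iff_dvd_diff algebra_simps)
    have A: "doob_sum (\<lambda>u. of_bool ([F' (vertex_append u v2) = c] (mod int (4 * w)))) v1
        = doob_sum (\<lambda>u. of_bool (S u = g \<and> [R u = q - F v2] (mod int w)) :: nat) v1"
      by (rule doob_sum_cong[OF v1])
        (simp only: F' vertex_take_append shift(1))
    have B: "doob_sum (\<lambda>u. of_bool ([F' (vertex_append v1 u) = c] (mod int (4 * w)))) v2
        = doob_sum (\<lambda>u. of_bool (S v1 = g) * of_bool ([F u = q - R v1] (mod int w)) :: nat) v2"
      by (rule doob_sum_cong[OF v2])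
        (simp only: F' vertex_take_append[OF v1] shift(2) of_bool_conj)
    have C: "[F' v = c] (mod int (4 * w)) \<longleftrightarrow> S v1 = g \<and> [F v2 = q - R v1] (mod int w)"
      by (simp only: v12 F' vertex_take_append[OF v1] shift(2))
    show "of_bool ([F' v = c] (mod int (4 * w))) + doob_sum (\<lambda>u. of_bool ([F' u = c] (mod int (4 * w)))) v = \<alpha>"
      unfolding C unfolding v12 doob_sum_append A B doob_sum_mult 1[OF v1]
      using 2[OF v2, of "q - R v1"] by (cases "S v1 = g") auto
  qed
qed

text \<open>The union of the classes numbered below l; \<open>l \<le> K\<close> keeps these residues
  distinct, and \<alpha> l > 0 makes the union nonempty.\<close>

lemma perfect_code_of_balanced_colouring:
  assumes "balanced_colouring m n \<alpha> K" "l \<in> {1..K}" "\<alpha> > 0"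
  shows "\<exists>C. multifold_perfect_code (doob_verts m n) doob_adj (\<alpha> * l) C"
proof -
  from assms(1) obtain F where F: "\<And>v c. v \<in> doob_verts m n \<Longrightarrow>
      of_bool ([F v = c] (mod int K)) + doob_sum (\<lambda>u. of_bool ([F u = c] (mod int K))) v = \<alpha>"
    unfolding balanced_colouring_def by blast
  define C where "C = {v \<in> doob_verts m n. F v mod int K < int l}"
  have inC: "of_bool (u \<in> C) = (\<Sum>i<l. of_bool ([F u = int i] (mod int K)) :: nat)"
    if "u \<in> doob_verts m n" for u
  proof -
    have *: "[F u = int i] (mod int K) \<longleftrightarrow> i = nat (F u mod int K)" if "i < l" for i
      using that assms(2) by (auto simp: cong_def)
    have "(\<Sum>i<l. of_bool ([F u = int i] (mod int K)) :: nat) = (\<Sum>i<l. of_bool (i = nat (F u mod int K)))"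
      by (rule sum.cong) (auto simp: *)
    also have "\<dots> = of_bool (nat (F u mod int K) < l)" by (simp add: of_bool_def)
    also have "nat (F u mod int K) < l \<longleftrightarrow> u \<in> C"
      using that assms(2) by (auto simp: C_def nat_less_iff)
    finally show ?thesis by simp
  qed
  have count: "card (C \<inter> unit_ball (doob_verts m n) doob_adj v) = \<alpha> * l" if v: "v \<in> doob_verts m n" for v
  proof -
    have "card (C \<inter> unit_ball (doob_verts m n) doob_adj v) =
        (\<Sum>i<l. of_bool ([F v = int i] (mod int K))) +
        doob_sum (\<lambda>u. \<Sum>i<l. of_bool ([F u = int i] (mod int K))) v"
      unfolding card_ball_inter[OF v] inC[OF v] using doob_sum_cong[OF v inC] by simp
    also have "\<dots> = (\<Sum>i<l. \<alpha>)"
      unfolding doob_sum_sum sum.distrib[symmetric] F[OF v] ..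
    finally show ?thesis by (simp add: mult.commute)
  qed
  have "C \<noteq> {}"
    using count[OF doob_verts_nonempty] assms(2,3) by force
  then show ?thesis
    using count unfolding multifold_perfect_code_def by (intro exI[of _ C]) (auto simp: C_def)
qed

subsection \<open>Latin colourings\<close>

lemma has_increments_shrikhande_hom:
  fixes h :: "4 \<times> 4 \<Rightarrow> 'g::ab_group_add"
  assumes "\<And>a b. h (a + b) = h a + h b"
  shows "has_increments 1 1 0 (\<lambda>x. \<Sum>c\<in>shrikhande_conn. of_bool (h c = x))"
  by (rule has_increments_shrikhande[of h])
    (auto simp: assms algebra_simps simp del: sum_of_bool_eq intro!: sum.cong arg_cong[of _ _ of_bool])

lemma has_increments_K4_hom:
  fixes h :: "4 \<Rightarrow> 'g::ab_group_add"
  assumes h: "\<And>a b. h (a + b) = h a + h b"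
  shows "has_increments 1 0 1 (\<lambda>x. \<Sum>c\<in>UNIV - {0}. of_bool (h c = x))"
proof (rule has_increments_K4[of h])
  fix x y
  show "(\<Sum>z\<in>UNIV - {y}. of_bool (h z = x)) = (\<Sum>c\<in>UNIV - {0}. of_bool (h c = x - h y) :: nat)"
    by (rule sum.reindex_bij_witness[of _ "\<lambda>c. y + c" "\<lambda>z. z - y"])
      (auto simp: algebra_simps simp flip: h)
qed

text \<open>Label the four entries 0, A, B, A + B. In characteristic 2 the differences from any
  label to the other three are again A, B and A + B.\<close>

lemma has_increments_K4_line:
  fixes A B :: "'g::ab_group_add"
  assumes two: "\<And>t::'g. t + t = 0"
  shows "has_increments 1 0 1 (\<lambda>x. of_bool (x = A) + of_bool (x = B) + of_bool (x = A + B))"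
proof -
  have cancel: "t + (t + s) = s" "t - s = t + s" for t s :: 'g
    using two[of t] two[of s] by (simp_all add: add.assoc[symmetric] diff_eq_eq)
  define f :: "4 \<Rightarrow> 'g" where "f y = (if y = 0 then 0 else if y = 1 then A else if y = 2 then B else A + B)" for y
  have "(\<Sum>z\<in>UNIV - {y}. of_bool (f z = x)) =
      (of_bool (x - f y = A) + of_bool (x - f y = B) + of_bool (x - f y = A + B) :: nat)" for x y
  proof -
    have x: "x - f y = t \<longleftrightarrow> f y + t = x" for t by (auto simp: algebra_simps)
    have "y \<in> {0, 1, 2, 3}" using UNIV_4 by blast
    then show ?thesis
      unfolding x unfolding UNIV_4
      by (elim insertE) (simp_all add: f_def insert_Diff_if two cancel add_ac del: sum_of_bool_eq)
  qed
  then show ?thesis by (rule has_increments_K4)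
qed

text \<open>
  For \<open>D \<noteq> 0\<close> the colouring below is not a homomorphism: the coefficient of \<open>D\<close> depends only on the
  difference of the two entries, is unchanged by \<open>(1, 1)\<close>, and is changed by exactly one of \<open>z + (1, 0)\<close>,
  \<open>z - (1, 0)\<close> and by exactly one of \<open>z + (0, 1)\<close>, \<open>z - (0, 1)\<close>.
\<close>

lemma has_increments_shrikhande_slot:
  fixes A B D :: "'g::ab_group_add"
  assumes two: "\<And>t::'g. t + t = 0"
  shows "has_increments 1 1 0 (\<lambda>x. of_bool (x = A) + of_bool (x = A + D) + of_bool (x = B) +
    of_bool (x = B + D) + 2 * of_bool (x = A + B))"
proof -
  have cancel: "t + (t + s) = s" for t s :: 'g
    using two[of t] by (simp add: add.assoc[symmetric])
  define f :: "4 \<times> 4 \<Rightarrow> 'g" where "f z = (if fst z \<in> {1, 3} then A else 0) + (if snd z \<in> {1, 3} then B else 0)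
    + (if snd z - fst z \<in> {2, 3} then D else 0)" for z
  have "(\<Sum>c\<in>shrikhande_conn. of_bool (f (z + c) = x)) =
      (of_bool (x - f z = A) + of_bool (x - f z = A + D) + of_bool (x - f z = B) +
       of_bool (x - f z = B + D) + 2 * of_bool (x - f z = A + B) :: nat)" for x z
  proof -
    have x: "x - f z = t \<longleftrightarrow> f z + t = x" for t by (auto simp: algebra_simps)
    have "fst z \<in> {0, 1, 2, 3}" "snd z \<in> {0, 1, 2, 3}" using UNIV_4 by blast+
    then obtain a b where z: "z = (a, b)" "a \<in> {0, 1, 2, 3}" "b \<in> {0, 1, 2, 3}" by (cases z) auto
    show ?thesis
      unfolding x unfolding z(1) sum_shrikhande_conn using z(2,3)
      by (elim insertE) (simp_all add: f_def numeral_mod_4 two cancel add_ac)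
  qed
  then show ?thesis by (rule has_increments_shrikhande)
qed

lemma add_self_2: "(t :: 2) + t = 0"
proof -
  have "t \<in> {0, 1}" using UNIV_2 by blast
  then show ?thesis by auto
qed

lemma add_self_2x2: "(t :: 2 \<times> 2) + t = 0"
  by (simp add: prod_eq_iff add_self_2)

lemma latin_K4: "latin 1 0 1 1"
proof -
  have "(\<lambda>x :: 2 \<times> 2. of_bool (x = (1, 0)) + of_bool (x = (0, 1)) + of_bool (x = (1, 0) + (0, 1)) :: nat) =
      (\<lambda>x. if x = 0 then 0 else 1)"
  proof
    fix x :: "2 \<times> 2"
    have "fst x \<in> {0, 1}" "snd x \<in> {0, 1}" using UNIV_2 by blast+
    then show "of_bool (x = (1, 0)) + of_bool (x = (0, 1)) + of_bool (x = (1, 0) + (0, 1)) = (if x = 0 then 0 else 1 :: nat)"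
      by (cases x) (auto simp: zero_prod_def)
  qed
  then show ?thesis using has_increments_K4_line[OF add_self_2x2, of "(1, 0)" "(0, 1)"] by simp
qed

lemma latin_shrikhande: "latin 1 1 0 2"
proof -
  have "(\<lambda>x :: 2 \<times> 2. of_bool (x = (1, 0)) + of_bool (x = (1, 0) + 0) + of_bool (x = (0, 1)) +
      of_bool (x = (0, 1) + 0) + 2 * of_bool (x = (1, 0) + (0, 1)) :: nat) =
      (\<lambda>x. if x = 0 then 0 else 2)"
  proof
    fix x :: "2 \<times> 2"
    have "fst x \<in> {0, 1}" "snd x \<in> {0, 1}" using UNIV_2 by blast+
    then show "of_bool (x = (1, 0)) + of_bool (x = (1, 0) + 0) + of_bool (x = (0, 1)) +
      of_bool (x = (0, 1) + 0) + 2 * of_bool (x = (1, 0) + (0, 1)) = (if x = 0 then 0 else 2 :: nat)"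
      by (cases x) (auto simp: zero_prod_def)
  qed
  then show ?thesis using has_increments_shrikhande_slot[OF add_self_2x2, of "(1, 0)" 0 "(0, 1)"] by simp
qed

lemma latin_add:
  assumes "latin w m1 n1 \<alpha>1" "latin w m2 n2 \<alpha>2"
  shows "latin w (m1 + m2) (n1 + n2) (\<alpha>1 + \<alpha>2)"
proof -
  have "(\<lambda>x :: 2 \<times> 2. (if x = 0 then 0 else \<alpha>1) + (if x = 0 then 0 else \<alpha>2)) = (\<lambda>x. if x = 0 then 0 else \<alpha>1 + \<alpha>2)"
    by auto
  then show ?thesis using has_increments_append[OF assms] by simp
qed

lemma latin_empty: "latin w 0 0 0"
  using has_increments_empty[of w] by simp

lemma latin_copies: "latin w m n \<alpha> \<Longrightarrow> latin w (j * m) (j * n) (j * \<alpha>)"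
proof (induction j)
  case 0
  then show ?case using latin_empty[of w] by (simp only: mult_0)
next
  case (Suc j)
  then show ?case using latin_add[of w m n \<alpha> "j * m" "j * n" "j * \<alpha>"] by (simp only: mult_Suc)
qed

text \<open>Unlike \<open>latin_add\<close>, gluing one block per element of 'd keeps \<alpha> and
  multiplies the number of colours by \<open>w0\<close>, the order of 'd.\<close>

lemma latin_blocks:
  fixes \<theta> :: "'d::{finite, ab_group_add} \<Rightarrow> 'd" and \<kappa> :: "'d \<Rightarrow> int"
  assumes two: "\<And>t::'d. t + t = 0" and \<theta>: "bij \<theta>" "bij (\<lambda>j. j + \<theta> j)"
    and \<kappa>: "\<And>c. \<exists>!d. [\<kappa> d = c] (mod int w0)" and "w0 > 0"
    and blocks: "\<And>j::'d. latin w (m j) (n j) \<alpha>"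
  shows "latin (w0 * w) (\<Sum>j\<in>UNIV. m j) (\<Sum>j\<in>UNIV. n j) \<alpha>"
proof -
  \<comment> \<open>Block \<open>j\<close> contributes \<open>\<psi> j\<close> of its Latin colour; for fixed \<open>x \<noteq> 0\<close> the value \<open>\<psi> j x\<close> runs
    through all of \<open>'d\<close> once, because \<open>\<theta>\<close> is a complete mapping.\<close>
  define \<psi> where "\<psi> j x = (if fst x = 1 then j else 0) + (if snd x = 1 then \<theta> j else 0)" for j and x :: "2 \<times> 2"
  have hom: "\<psi> j (a - b) = \<psi> j a - \<psi> j b" for j a b
  proof -
    have pick: "(if x - y = 1 then t else 0) = (if x = 1 then t else 0) - (if y = 1 then t else 0)"
      for x y :: 2 and t :: 'd
    proof -
      have "x \<in> {0, 1}" "y \<in> {0, 1}" using UNIV_2 by blast+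
      then show ?thesis using two[of t] by (auto simp: eq_neg_iff_add_eq_0)
    qed
    show ?thesis unfolding \<psi>_def fst_diff snd_diff pick by (simp add: algebra_simps)
  qed
  have ex1: "card {j. \<psi> j x = d} = 1" if "x \<noteq> 0" for x d
  proof -
    have "fst x \<in> {0, 1}" "snd x \<in> {0, 1}" using UNIV_2 by blast+
    with that consider "x = (0, 1)" | "x = (1, 0)" | "x = (1, 1)"
      by (cases x) (auto simp: zero_prod_def)
    then have "bij (\<lambda>j. \<psi> j x)"
    proof cases
      case 1
      then show ?thesis using \<theta>(1) by (simp add: \<psi>_def)
    next
      case 2
      then show ?thesis by (simp add: \<psi>_def flip: id_def)
    next
      case 3
      then show ?thesis using \<theta>(2) by (simp add: \<psi>_def)
    qed
    then have "\<exists>!j. \<psi> j x = d" by (simp add: bij_iff)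
    then obtain j where "\<And>i. \<psi> i x = d \<longleftrightarrow> i = j" by (auto simp: Ex1_def)
    then show ?thesis by simp
  qed
  have "has_increments w (m j) (n j) (\<lambda>y. of_bool (snd y = \<psi> j (fst y)) * (if fst y = 0 then 0 else \<alpha>))" for j
  proof -
    have "(\<lambda>y. \<Sum>e | (e, \<psi> j e) = y. if e = 0 then 0 else \<alpha>) =
        (\<lambda>y. of_bool (snd y = \<psi> j (fst y)) * (if fst y = 0 then 0 else \<alpha>))"
    proof
      fix y
      have "{e. (e, \<psi> j e) = y} = (if snd y = \<psi> j (fst y) then {fst y} else {})" by (cases y) auto
      then show "(\<Sum>e | (e, \<psi> j e) = y. if e = 0 then 0 else \<alpha>) = of_bool (snd y = \<psi> j (fst y)) * (if fst y = 0 then 0 else \<alpha>)"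
        by simp
    qed
    then show ?thesis
      using has_increments_pushforward[OF blocks[of j], of "\<lambda>e. (e, \<psi> j e)"] by (simp add: hom)
  qed
  then have "has_increments w (\<Sum>j\<in>UNIV. m j) (\<Sum>j\<in>UNIV. n j)
      (\<lambda>y. \<Sum>j\<in>UNIV. of_bool (snd y = \<psi> j (fst y)) * (if fst y = 0 then 0 else \<alpha>))"
    by (intro has_increments_sum) simp_all
  also have "(\<lambda>y. \<Sum>j\<in>UNIV. of_bool (snd y = \<psi> j (fst y)) * (if fst y = 0 then 0 else \<alpha>)) =
      (\<lambda>y. if fst y = 0 then 0 else \<alpha>)"
  proof
    fix y :: "(2 \<times> 2) \<times> 'd"
    have "(\<Sum>j\<in>UNIV. of_bool (snd y = \<psi> j (fst y)) * (if fst y = 0 then 0 else \<alpha>)) =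
        card {j. \<psi> j (fst y) = snd y} * (if fst y = 0 then 0 else \<alpha>)"
      by (simp add: eq_commute[of "snd y"] flip: sum_distrib_right)
    then show "(\<Sum>j\<in>UNIV. of_bool (snd y = \<psi> j (fst y)) * (if fst y = 0 then 0 else \<alpha>)) = (if fst y = 0 then 0 else \<alpha>)"
      using ex1[of "fst y" "snd y"] by auto
  qed
  \<comment> \<open>The increments now depend on the first component alone, so the part in 'd moves
    into the second.\<close>
  finally show ?thesis
  proof (rule has_increments_regroup[where \<kappa> = "\<lambda>y. \<kappa> (snd y)"])
    fix x :: "2 \<times> 2" and c
    obtain d where "\<And>e. [\<kappa> e = c] (mod int w0) \<longleftrightarrow> e = d" using \<kappa>[of c] by metis
    then show "\<exists>!y. fst y = x \<and> [\<kappa> (snd y) = c] (mod int w0)" by (auto simp: prod_eq_iff)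
  qed (simp_all add: assms)
qed

lemma add_self_2x2x2: "(t :: 2 \<times> 2 \<times> 2) + t = 0"
  by (simp add: prod_eq_iff add_self_2)

lemma bij_of_inj: "inj f \<Longrightarrow> bij (f :: 'a::finite \<Rightarrow> 'a)"
  by (simp add: bij_def finite_UNIV_inj_surj)

lemma latin_blocks_4:
  assumes "\<And>j::2\<times>2. latin w (m j) (n j) \<alpha>"
  shows "latin (4 * w) (\<Sum>j\<in>UNIV. m j) (\<Sum>j\<in>UNIV. n j) \<alpha>"
proof (rule latin_blocks[OF add_self_2x2 _ _ bits2_code _ assms])
  \<comment> \<open>Multiplication by a primitive element \<omega> of the field with four elements,
    in the basis 1, \<omega>; adding the identity gives multiplication by 1 + \<omega>, again
    nonzero.\<close>
  show "bij (\<lambda>j::2\<times>2. (snd j, fst j + snd j))"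
    by (rule bij_of_inj) (auto simp: inj_on_def)
  have "2 * t = 0" for t :: 2 by (simp only: mult_2 add_self_2)
  then show "bij (\<lambda>j::2\<times>2. j + (snd j, fst j + snd j))"
    by (intro bij_of_inj) (auto simp: inj_on_def)
qed simp

lemma latin_K4_4: "latin 4 0 4 1"
  using latin_blocks_4[of 1 "\<lambda>_. 0" "\<lambda>_. 1" 1] latin_K4 by simp

lemma latin_K4_8: "latin 8 0 8 1"
proof -
  \<comment> \<open>Multiplication by a root \<omega> of \<open>X^3 + X + 1\<close> in the field
    with eight elements, in the basis 1, \<omega>, \<open>\<omega>^2\<close>.\<close>
  let ?\<theta> = "\<lambda>j::2\<times>2\<times>2. (snd (snd j), fst j + snd (snd j), fst (snd j))"
  have "bij ?\<theta>"
    by (rule bij_of_inj) (auto simp: inj_on_def)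
  moreover have "bij (\<lambda>j. j + ?\<theta> j)"
    by (rule bij_of_inj) (auto simp: inj_on_def algebra_simps)
  ultimately show ?thesis
    using latin_blocks[OF add_self_2x2x2 _ _ bits3_code, of ?\<theta> 1 "\<lambda>_. 0" "\<lambda>_. 1" 1] latin_K4 by simp
qed

section \<open>Latin blocks of Shrikhande coordinates\<close>

definition low_bit :: "4 \<Rightarrow> 2" where "low_bit y = (if y \<in> {0, 2} then 0 else 1)"
definition high_bit :: "4 \<Rightarrow> 2" where "high_bit y = (if y \<in> {0, 1} then 0 else 1)"

lemma low_bit_add: "low_bit (a + b) = low_bit a + low_bit b"
proof -
  have "a \<in> {0, 1, 2, 3}" "b \<in> {0, 1, 2, 3}" using UNIV_4 by blast+
  then show ?thesis by (elim insertE) (simp_all add: low_bit_def numeral_mod_4)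
qed

lemma low_bit_diff: "low_bit (a - b) = low_bit a - low_bit b"
  using low_bit_add[of "a - b" b] by simp

lemma bits_4: "\<exists>!y. low_bit y = a \<and> high_bit y = b"
proof -
  let ?y = "if b = 0 then (if a = 0 then 0 else 1) else (if a = 0 then 2 else 3) :: 4"
  have "low_bit y = a \<and> high_bit y = b \<longleftrightarrow> y = ?y" for y
  proof -
    have "y \<in> {0, 1, 2, 3}" using UNIV_4 by blast
    moreover have "a \<in> {0, 1}" "b \<in> {0, 1}" using UNIV_2 by blast+
    ultimately show ?thesis
      by (elim insertE) (simp_all add: low_bit_def high_bit_def)
  qed
  then show ?thesis by simp
qed

text \<open>Supplies the numbering of fibres for \<open>has_increments_regroup\<close> when \<sigma>
  is reduction modulo 2: the high bits and the last component number a fibre.\<close>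

lemma high_bits_code:
  fixes \<kappa> :: "(2 \<times> 2) \<times> 'a \<Rightarrow> int"
  assumes "\<And>c. \<exists>!d. [\<kappa> d = c] (mod w0)"
  shows "\<exists>!z. (low_bit (fst (fst z)), low_bit (snd (fst z))) = x \<and>
    [\<kappa> ((high_bit (fst (fst z)), high_bit (snd (fst z))), snd z) = c] (mod w0)"
proof -
  obtain d where d: "\<And>e. [\<kappa> e = c] (mod w0) \<longleftrightarrow> e = d" using assms[of c] by metis
  obtain a where a: "\<And>y. low_bit y = fst x \<and> high_bit y = fst (fst d) \<longleftrightarrow> y = a"
    using bits_4 by metis
  obtain b where b: "\<And>y. low_bit y = snd x \<and> high_bit y = snd (fst d) \<longleftrightarrow> y = b"
    using bits_4 by metis
  have "(low_bit (fst (fst z)), low_bit (snd (fst z))) = x \<and>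
    [\<kappa> ((high_bit (fst (fst z)), high_bit (snd (fst z))), snd z) = c] (mod w0) \<longleftrightarrow> z = ((a, b), snd d)" for z
    unfolding d using a[of "fst (fst z)"] b[of "snd (fst z)"] by (auto simp: prod_eq_iff)
  then show ?thesis by simp
qed

text \<open>The identity and a second matrix congruent to it modulo 2 send the connection set onto
  two disjoint sets of six elements; together they are the 12 elements of \<open>Z4^2\<close> that
  are nonzero modulo 2.\<close>

lemma latin_shrikhande_4: "latin 4 2 0 1"
proof -
  let ?\<sigma> = "\<lambda>z :: 4 \<times> 4. (low_bit (fst z), low_bit (snd z))"
  have "has_increments 1 1 0 (\<lambda>x::4\<times>4. \<Sum>c\<in>shrikhande_conn. of_bool (c = x))"
    by (rule has_increments_shrikhande_hom) simp
  moreover have "has_increments 1 1 0 (\<lambda>x::4\<times>4. \<Sum>c\<in>shrikhande_conn.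
      of_bool ((fst c + 2 * snd c, 2 * fst c + 3 * snd c) = x))"
    by (rule has_increments_shrikhande_hom) (simp add: algebra_simps)
  ultimately have "has_increments 1 (1 + 1) (0 + 0) (\<lambda>x::4\<times>4. (\<Sum>c\<in>shrikhande_conn. of_bool (c = x)) +
      (\<Sum>c\<in>shrikhande_conn. of_bool ((fst c + 2 * snd c, 2 * fst c + 3 * snd c) = x)))"
    by (rule has_increments_append)
  also have "(\<lambda>x::4\<times>4. (\<Sum>c\<in>shrikhande_conn. of_bool (c = x)) +
      (\<Sum>c\<in>shrikhande_conn. of_bool ((fst c + 2 * snd c, 2 * fst c + 3 * snd c) = x))) =
      (\<lambda>x. if ?\<sigma> x = 0 then 0 else 1 :: nat)"
  proof
    fix x :: "4 \<times> 4"
    have "fst x \<in> {0, 1, 2, 3}" "snd x \<in> {0, 1, 2, 3}" using UNIV_4 by blast+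
    then obtain a b where "x = (a, b)" "a \<in> {0, 1, 2, 3}" "b \<in> {0, 1, 2, 3}" by (cases x) auto
    then show "(\<Sum>c\<in>shrikhande_conn. of_bool (c = x)) +
      (\<Sum>c\<in>shrikhande_conn. of_bool ((fst c + 2 * snd c, 2 * fst c + 3 * snd c) = x)) =
      (if ?\<sigma> x = 0 then 0 else 1 :: nat)"
      unfolding sum_shrikhande_conn
      by (elim insertE) (simp_all add: low_bit_def numeral_mod_4 zero_prod_def)
  qed
  finally have "has_increments 1 2 0 (\<lambda>x. if ?\<sigma> x = 0 then 0 else 1 :: nat)" by (simp add: eval_nat_numeral)
  then have "latin (4 * 1) 2 0 1"
  proof (rule has_increments_regroup[where \<kappa> = "\<lambda>z. bits2 (high_bit (fst z), high_bit (snd z))"])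
    fix x :: "2 \<times> 2" and c
    \<comment> \<open>The high bits alone number a fibre here, so the last component is the
      one-element type.\<close>
    have "\<exists>!d :: (2 \<times> 2) \<times> unit. [bits2 (fst d) = c] (mod int 4)" for c
    proof -
      obtain e where "\<And>d. [bits2 d = c] (mod int 4) \<longleftrightarrow> d = e" using bits2_code[of c] by metis
      then show ?thesis by (auto simp: prod_eq_iff)
    qed
    from high_bits_code[OF this, of x c]
    show "\<exists>!z. (low_bit (fst z), low_bit (snd z)) = x \<and> [bits2 (high_bit (fst z), high_bit (snd z)) = c] (mod int 4)"
      by auto
  qed (simp_all add: low_bit_diff)
  then show ?thesis by simp
qed

lemma latin_shrikhande_8: "latin 8 4 0 1"
proof -
  let ?\<sigma> = "\<lambda>z :: (4 \<times> 4) \<times> 2. (low_bit (fst (fst z)), low_bit (snd (fst z)))"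
  \<comment> \<open>The \<open>Z\<^sub>4\<^sup>2\<close> components are congruent to the identity modulo 2. The four choices are such that the
    24 images of the connection set are exactly the elements that are nonzero modulo 2.\<close>
  let ?h = "\<lambda>(\<delta>::2) (\<epsilon>::2) p q r (c::4\<times>4). ((p * fst c + q * snd c, r * fst c + snd c),
     \<delta> * low_bit (fst c) + \<epsilon> * low_bit (snd c)) :: (4 \<times> 4) \<times> 2"
  have hom: "has_increments 1 1 0 (\<lambda>x. \<Sum>c\<in>shrikhande_conn. of_bool (?h \<delta> \<epsilon> p q r c = x))" for \<delta> \<epsilon> p q r
    by (rule has_increments_shrikhande_hom) (simp add: algebra_simps low_bit_add)
  have "has_increments 1 (1 + 1 + (1 + 1)) (0 + 0 + (0 + 0)) (\<lambda>x.
      (\<Sum>c\<in>shrikhande_conn. of_bool (?h 0 0 1 0 0 c = x)) + (\<Sum>c\<in>shrikhande_conn. of_bool (?h 0 1 3 0 2 c = x)) +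
      ((\<Sum>c\<in>shrikhande_conn. of_bool (?h 1 0 1 2 0 c = x)) + (\<Sum>c\<in>shrikhande_conn. of_bool (?h 1 1 3 2 2 c = x))))"
    by (intro has_increments_append hom)
  also have "(\<lambda>x.
      (\<Sum>c\<in>shrikhande_conn. of_bool (?h 0 0 1 0 0 c = x)) + (\<Sum>c\<in>shrikhande_conn. of_bool (?h 0 1 3 0 2 c = x)) +
      ((\<Sum>c\<in>shrikhande_conn. of_bool (?h 1 0 1 2 0 c = x)) + (\<Sum>c\<in>shrikhande_conn. of_bool (?h 1 1 3 2 2 c = x)))) =
      (\<lambda>x. if ?\<sigma> x = 0 then 0 else 1 :: nat)" (is "?f = ?g")
  proof
    fix x :: "(4 \<times> 4) \<times> 2"
    have "fst (fst x) \<in> {0, 1, 2, 3}" "snd (fst x) \<in> {0, 1, 2, 3}" "snd x \<in> {0, 1}"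
      using UNIV_4 UNIV_2 by blast+
    then obtain a b e where "x = ((a, b), e)" "a \<in> {0, 1, 2, 3}" "b \<in> {0, 1, 2, 3}" "e \<in> {0, 1}"
      by (cases x) auto
    then show "?f x = ?g x"
      unfolding sum_shrikhande_conn
      by (elim insertE) (simp_all add: low_bit_def numeral_mod_4 zero_prod_def)
  qed
  finally have "has_increments 1 4 0 (\<lambda>x. if ?\<sigma> x = 0 then 0 else 1 :: nat)" by (simp add: eval_nat_numeral)
  then have "latin (8 * 1) 4 0 1"
  proof (rule has_increments_regroup[where
        \<kappa> = "\<lambda>z. bits3 (snd z, (high_bit (fst (fst z)), high_bit (snd (fst z))))"])
    fix x :: "2 \<times> 2" and c
    have "\<exists>!d :: (2 \<times> 2) \<times> 2. [bits3 (snd d, fst d) = c] (mod int 8)" for c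
    proof -
      obtain e where "\<And>d. [bits3 d = c] (mod int 8) \<longleftrightarrow> d = e" using bits3_code[of c] by metis
      then show ?thesis by (auto simp: prod_eq_iff)
    qed
    from high_bits_code[OF this, of x c]
    show "\<exists>!z. (low_bit (fst (fst z)), low_bit (snd (fst z))) = x \<and>
        [bits3 (snd z, (high_bit (fst (fst z)), high_bit (snd (fst z)))) = c] (mod int 8)"
      by simp
  qed (simp_all add: low_bit_diff)
  then show ?thesis by simp
qed

section \<open>Blocks mixing both kinds of coordinates\<close>

lemma bounded_summands:
  "finite I \<Longrightarrow> j \<le> card I * N \<Longrightarrow> \<exists>f. (\<forall>i\<in>I. f i \<le> N) \<and> (\<Sum>i\<in>I. f i) = (j::nat)"
proof (induction I arbitrary: j rule: finite_induct)
  case empty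
  then show ?case by simp
next
  case (insert a I)
  \<comment> \<open>Greedy choice: the new index takes as much of j as the bound allows.\<close>
  then have "j - min j N \<le> card I * N" by auto
  from insert.IH[OF this] obtain f where f: "\<forall>i\<in>I. f i \<le> N" "(\<Sum>i\<in>I. f i) = j - min j N" by blast
  have "(\<Sum>i\<in>I. (f(a := min j N)) i) = (\<Sum>i\<in>I. f i)"
    using insert.hyps by (intro sum.cong) auto
  then show ?case
    using f insert.hyps by (intro exI[of _ "f(a := min j N)"]) auto
qed

text \<open>There are \<open>\<alpha> * 4 ^ s\<close> blocks, and j of them consist of
  \<open>a\<close> Shrikhande coordinates, the others of \<open>2 * a\<close> K4 coordinates. Adding
  \<alpha> blocks gives multiplicity \<alpha>; each of s rounds glues four families, among which j
  is distributed.\<close>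

lemma latin_family:
  assumes "latin w0 a 0 1" "latin w0 0 (2 * a) 1"
  shows "j \<le> \<alpha> * 4 ^ s \<Longrightarrow> latin (4 ^ s * w0) (a * j) (2 * a * (\<alpha> * 4 ^ s - j)) \<alpha>"
proof (induction s arbitrary: j)
  case 0
  have "latin w0 (j * a + (\<alpha> - j) * 0) (j * 0 + (\<alpha> - j) * (2 * a)) (j * 1 + (\<alpha> - j) * 1)"
    by (intro latin_add latin_copies assms)
  also have "j * a + (\<alpha> - j) * 0 = a * j" by simp
  also have "j * 0 + (\<alpha> - j) * (2 * a) = 2 * a * (\<alpha> - j)" by simp
  also have "j * 1 + (\<alpha> - j) * 1 = \<alpha>" using 0 by simp
  finally show ?case by simp
next
  case (Suc s)
  let ?N = "\<alpha> * 4 ^ s"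
  have "j \<le> card (UNIV :: (2 \<times> 2) set) * ?N" using Suc.prems by simp
  from bounded_summands[OF finite this] obtain f :: "2 \<times> 2 \<Rightarrow> nat"
    where f': "\<forall>i\<in>UNIV. f i \<le> ?N" and f: "(\<Sum>i\<in>UNIV. f i) = j" by blast
  from f' have le: "f i \<le> ?N" for i by blast
  have "latin (4 * (4 ^ s * w0)) (\<Sum>i\<in>UNIV. a * f i) (\<Sum>i\<in>UNIV. 2 * a * (?N - f i)) \<alpha>"
    by (rule latin_blocks_4) (rule Suc.IH, rule le)
  moreover have "(\<Sum>i\<in>UNIV. a * f i) = a * j"
    by (simp only: f sum_distrib_left[symmetric])
  moreover have "(\<Sum>i\<in>UNIV. ?N - f i) = \<alpha> * 4 ^ Suc s - j"
    unfolding sum_subtractf_nat[OF le] f by simp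
  then have "(\<Sum>i\<in>UNIV. 2 * a * (?N - f i)) = 2 * a * (\<alpha> * 4 ^ Suc s - j)"
    by (simp only: sum_distrib_left[symmetric])
  moreover have "4 * (4 ^ s * w0) = 4 ^ Suc s * w0" by simp
  ultimately show ?case by (simp only:)
qed

subsection \<open>Balanced colourings\<close>

text \<open>
  The increments of two units of weight, realisable either by one Shrikhande coordinate or by two
  \<open>K\<^sub>4\<close> coordinates with the lines spanned by \<open>A, B\<close> and by \<open>A + D, B + D\<close>.
\<close>

definition slot :: "'g \<times> 'g \<times> 'g \<Rightarrow> 'g::ab_group_add \<Rightarrow> nat" where
  "slot = (\<lambda>(A, B, D) x. of_bool (x = A) + of_bool (x = A + D) + of_bool (x = B) +
    of_bool (x = B + D) + 2 * of_bool (x = A + B))"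

text \<open>The first j slots use Shrikhande coordinates and the others pairs of K4 coordinates, so
  the increments do not depend on j.\<close>

lemma has_increments_slots:
  fixes s :: "('g::ab_group_add \<times> 'g \<times> 'g) list"
  assumes two: "\<And>t::'g. t + t = 0"
  shows "j \<le> length s \<Longrightarrow> has_increments 1 j (2 * (length s - j)) (\<lambda>x. \<Sum>t\<leftarrow>s. slot t x)"
proof (induction s arbitrary: j)
  case Nil
  then show ?case by (simp add: has_increments_empty)
next
  case (Cons t s)
  obtain A B D where t: "t = (A, B, D)" by (cases t) auto
  show ?case
  proof (cases j)
    case 0
    have cancel: "A + D + (B + D) = A + B"
      using two[of D] by (metis (no_types, opaque_lifting) add.assoc add.left_commute add.right_neutral)
    have "has_increments 1 (0 + 0) (1 + 1) (\<lambda>x. (of_bool (x = A) + of_bool (x = B) + of_bool (x = A + B)) +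
      (of_bool (x = A + D) + of_bool (x = B + D) + of_bool (x = A + D + (B + D))))"
      by (intro has_increments_append has_increments_K4_line two)
    also have "(\<lambda>x. (of_bool (x = A) + of_bool (x = B) + of_bool (x = A + B)) +
      (of_bool (x = A + D) + of_bool (x = B + D) + of_bool (x = A + D + (B + D)))) = slot t"
      by (rule ext) (simp only: cancel, simp add: slot_def t)
    finally have "has_increments 1 (0 + 0 + 0) (1 + 1 + 2 * (length s - 0)) (\<lambda>x. slot t x + (\<Sum>t\<leftarrow>s. slot t x))"
      by (rule has_increments_append) (rule Cons.IH, simp)
    then show ?thesis using 0 by simp
  next
    case (Suc i)
    have "has_increments 1 1 0 (slot t)"
      using has_increments_shrikhande_slot[OF two, of A D B] by (simp add: slot_def t)
    then have "has_increments 1 (1 + i) (0 + 2 * (length s - i)) (\<lambda>x. slot t x + (\<Sum>t\<leftarrow>s. slot t x))"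
      by (rule has_increments_append) (rule Cons.IH, use Suc Cons.prems in simp)
    then show ?thesis using Suc by simp
  qed
qed

lemma sum_list_concat_replicate:
  "(\<Sum>x\<leftarrow>concat (replicate t s). f x) = t * (\<Sum>x\<leftarrow>s. f x :: nat)"
  by (induction t) simp_all

text \<open>Since n is odd, one K4 coordinate can be set aside; the remaining even weight is filled
  with slots in \<open>Z2^3\<close>, whose increments are the same for every m.\<close>

lemma balanced_colouring_8:
  assumes "2 * m + n = 13 + 16 * t"
  shows "balanced_colouring m n (5 + 6 * t) 8"
proof -
  let ?a = "(1, 0, 0) :: 2 \<times> 2 \<times> 2" and ?b = "(0, 1, 0) :: 2 \<times> 2 \<times> 2" and ?c = "(0, 0, 1) :: 2 \<times> 2 \<times> 2"
  \<comment> \<open>\<open>?L\<close> consists of the four lines of the Fano plane that avoid \<open>?a\<close>; the nonzero slots of \<open>?r\<close>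
    are all seven lines.\<close>
  let ?L = "[(?b, ?c, 0), (?a + ?b, ?c, 0), (?b, ?a + ?c, 0), (?a + ?b, ?a + ?c, 0)]"
  \<comment> \<open>\<open>?L\<close> covers every nonzero element but \<open>?a\<close> four times.
    The two further slots give \<open>?b\<close>, \<open>?c\<close>, \<open>?a + ?b\<close>,
    \<open>?a + ?c\<close> once and \<open>?a\<close> and 0 four times; the line through
    \<open>?a\<close> and \<open>?b + ?c\<close> and the vertex itself raise all counts to
    5.\<close>
  let ?s = "?L @ [(?b, ?a + ?b, ?b + ?c), (0, 0, ?a)]"
  let ?r = "?L @ [(?a, ?b, 0), (?a, ?c, 0), (?a, ?b + ?c, 0), (0, 0, 0)]"
  let ?w = "?s @ concat (replicate t ?r)"
  have len: "length ?w = 6 + 8 * t"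
    by (simp add: length_concat sum_list_replicate)
  then have m: "m \<le> length ?w" using assms by simp
  have "has_increments 1 (m + 0) (2 * (length ?w - m) + 1) (\<lambda>x. (\<Sum>t\<leftarrow>?w. slot t x) +
      (of_bool (x = ?a) + of_bool (x = ?b + ?c) + of_bool (x = ?a + (?b + ?c))))"
    by (intro has_increments_append has_increments_slots[OF add_self_2x2x2 m]
        has_increments_K4_line[OF add_self_2x2x2])
  also have "2 * (length ?w - m) + 1 = n" using assms m unfolding len by linarith
  finally have "has_increments 1 m n (\<lambda>x. (\<Sum>t\<leftarrow>?w. slot t x) +
      (of_bool (x = ?a) + of_bool (x = ?b + ?c) + of_bool (x = ?a + (?b + ?c))))" by simp
  then show ?thesis
  proof (rule balanced_colouring_of_increments[where \<kappa> = bits3])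
    show "\<exists>!g. [bits3 g = c] (mod int 8)" for c by (rule bits3_code)
    fix x :: "2 \<times> 2 \<times> 2"
    have "fst x \<in> {0, 1}" "fst (snd x) \<in> {0, 1}" "snd (snd x) \<in> {0, 1}" using UNIV_2 by blast+
    then obtain i j k where x: "x = (i, j, k)" "i \<in> {0, 1}" "j \<in> {0, 1}" "k \<in> {0, 1}"
      by (cases x) auto
    have s: "of_bool (x = 0) + (\<Sum>t\<leftarrow>?s. slot t x) +
      (of_bool (x = ?a) + of_bool (x = ?b + ?c) + of_bool (x = ?a + (?b + ?c))) = (5 :: nat)"
      using x(2-) unfolding x(1) by (elim insertE) (simp_all add: slot_def zero_prod_def)
    have r: "(\<Sum>t\<leftarrow>?r. slot t x) = 6"
      using x(2-) unfolding x(1) by (elim insertE) (simp_all add: slot_def zero_prod_def)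
    show "of_bool (x = 0) + ((\<Sum>t\<leftarrow>?w. slot t x) +
      (of_bool (x = ?a) + of_bool (x = ?b + ?c) + of_bool (x = ?a + (?b + ?c)))) = 5 + 6 * t"
      unfolding map_append[of _ ?s] sum_list_append[of "map _ ?s"] sum_list_concat_replicate r
      using s by linarith
  qed
qed

text \<open>The nonzero elements of \<open>Z4^2\<close> split into the connection set and the
  nonzero multiples of (1, 2), (2, 1) and (1, 3).\<close>

lemma balanced_colouring_1_3: "balanced_colouring 1 3 1 16"
proof -
  let ?h = "\<lambda>p q (y::4). (p * y, q * y)"
  have K4: "has_increments 1 0 1 (\<lambda>x. \<Sum>c\<in>UNIV - {0}. of_bool (?h p q c = x))" for p q
    by (rule has_increments_K4_hom) (simp add: algebra_simps)
  have Sh: "has_increments 1 1 0 (\<lambda>x::4\<times>4. \<Sum>c\<in>shrikhande_conn. of_bool (c = x))"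
    by (rule has_increments_shrikhande_hom) simp
  have "has_increments 1 (1 + (0 + (0 + 0))) (0 + (1 + (1 + 1))) (\<lambda>x. (\<Sum>c\<in>shrikhande_conn. of_bool (c = x)) +
      ((\<Sum>c\<in>UNIV - {0}. of_bool (?h 1 2 c = x)) + ((\<Sum>c\<in>UNIV - {0}. of_bool (?h 2 1 c = x)) +
       (\<Sum>c\<in>UNIV - {0}. of_bool (?h 1 3 c = x)))))"
    by (intro has_increments_append K4 Sh)
  then have "balanced_colouring (1 + (0 + (0 + 0))) (0 + (1 + (1 + 1))) 1 16"
  proof (rule balanced_colouring_of_increments[where
        \<kappa> = "\<lambda>z. bits2 (low_bit (fst z), low_bit (snd z)) mod 4 + 4 * bits2 (high_bit (fst z), high_bit (snd z))"])
    fix x :: "4 \<times> 4"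
    have "fst x \<in> {0, 1, 2, 3}" "snd x \<in> {0, 1, 2, 3}" using UNIV_4 by blast+
    then obtain a b where x: "x = (a, b)" "a \<in> {0, 1, 2, 3}" "b \<in> {0, 1, 2, 3}" by (cases x) auto
    have "UNIV - {0} = {1, 2, 3 :: 4}" unfolding UNIV_4 by auto
    then have sum: "(\<Sum>c\<in>UNIV - {0}. f c) = f 1 + f 2 + f 3" for f :: "4 \<Rightarrow> nat" by simp
    show "of_bool (x = 0) + ((\<Sum>c\<in>shrikhande_conn. of_bool (c = x)) +
      ((\<Sum>c\<in>UNIV - {0}. of_bool (?h 1 2 c = x)) + ((\<Sum>c\<in>UNIV - {0}. of_bool (?h 2 1 c = x)) +
       (\<Sum>c\<in>UNIV - {0}. of_bool (?h 1 3 c = x))))) = (1 :: nat)"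
      using x(2-) unfolding sum sum_shrikhande_conn x(1)
      by (elim insertE) (simp_all add: numeral_mod_4 zero_prod_def)
  next
    fix c
    have "\<exists>!e. [bits2 (fst e) mod 4 + 4 * bits2 (snd e) = c] (mod 16)"
      using code_pair[OF bits2_code bits2_code, of c] by simp
    then obtain d where d: "\<And>e. [bits2 (fst e) mod 4 + 4 * bits2 (snd e) = c] (mod 16) \<longleftrightarrow> e = d"
      by metis
    obtain a where a: "\<And>y. low_bit y = fst (fst d) \<and> high_bit y = fst (snd d) \<longleftrightarrow> y = a"
      using bits_4 by metis
    obtain b where b: "\<And>y. low_bit y = snd (fst d) \<and> high_bit y = snd (snd d) \<longleftrightarrow> y = b"
      using bits_4 by metis
    have "[bits2 (low_bit (fst z), low_bit (snd z)) mod 4 + 4 * bits2 (high_bit (fst z), high_bit (snd z)) = c] (mod int 16)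
        \<longleftrightarrow> z = (a, b)" for z
      using d[of "((low_bit (fst z), low_bit (snd z)), (high_bit (fst z), high_bit (snd z)))"]
        a[of "fst z"] b[of "snd z"] by (auto simp: prod_eq_iff)
    then show "\<exists>!z. [bits2 (low_bit (fst z), low_bit (snd z)) mod 4 + 4 * bits2 (high_bit (fst z), high_bit (snd z)) = c] (mod int 16)"
      by simp
  qed
  then show ?thesis by (simp add: eval_nat_numeral)
qed

text \<open>Induction from k - 2 to k by \<open>balanced_colouring_step\<close>; as k = 1 is
  excluded, k = 3 has to be a base case.\<close>

lemma balanced_colouring_exists:
  assumes "odd \<alpha>"
  shows "6 * m + 3 * n + 1 = \<alpha> * 2 ^ k \<Longrightarrow> k \<noteq> 1 \<Longrightarrow> balanced_colouring m n \<alpha> (2 ^ k)"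
proof (induction k arbitrary: m n rule: less_induct)
  case (less k)
  have "k = 0 \<or> k = 3 \<or> (k = (k - 2) + 2 \<and> k - 2 \<noteq> 1)" using less.prems(2) by linarith
  then consider "k = 0" | "k = 3" | k' where "k = k' + 2" "k' \<noteq> 1" by blast
  then show ?case
  proof cases
    case 1
    then show ?thesis using balanced_colouring_trivial[of m n] less.prems(1) by simp
  next
    case 2
    then have "6 * m + 3 * n + 1 = 8 * \<alpha>" using less.prems(1) by simp
    define x where "x = 2 * m + n"
    have 8: "3 * x + 1 = 8 * \<alpha>" using \<open>6 * m + 3 * n + 1 = 8 * \<alpha>\<close> by (simp add: x_def)
    obtain b where b: "\<alpha> = 2 * b + 1" using assms by (auto elim: oddE)
    \<comment> \<open>The solutions of 3x + 1 = 8(2b + 1) are b = 2 + 3t, x = 13 + 16t, so that t =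
      x - 5b - 3.\<close>
    have "5 * b + 3 \<le> x" using 8 b by linarith
    then obtain t where x: "x = 5 * b + 3 + t" using le_Suc_ex by blast
    then have "b = 2 + 3 * t" using 8 b by linarith
    then have t: "\<alpha> = 5 + 6 * t" "2 * m + n = 13 + 16 * t" using b x by (simp_all add: x_def)
    then show ?thesis using balanced_colouring_8[of m n t] 2 t by simp
  next
    case (3 k')
    \<comment> \<open>M is the weight of the Latin part and N that of the rest; the rest has balls
      of size 3N + 1 = M, as the induction hypothesis requires.\<close>
    define M where "M = \<alpha> * 2 ^ k'"
    define x where "x = 2 * m + n"
    have M: "3 * x + 1 = 4 * M" using less.prems(1) by (simp add: x_def M_def 3(1))
    then have "M \<le> x" by linarith
    then obtain N where x: "x = M + N" using le_Suc_ex by blast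
    then have N: "2 * m + n = 4 * N + 1" "M = 3 * N + 1" using M by (simp_all add: x_def)
    \<comment> \<open>\<open>m1\<close> Shrikhande coordinates go to the Latin part; the remaining
      ones have to fit into weight N.\<close>
    have step: ?thesis if "latin (2 ^ k') m1 (M - 2 * m1) \<alpha>" "2 * m1 \<le> M" "m1 \<le> m" "2 * (m - m1) \<le> N" for m1
    proof -
      have "balanced_colouring (m - m1) (N - 2 * (m - m1)) \<alpha> (2 ^ k')"
        using that N 3 by (intro less.IH) (auto simp: M_def)
      then have "balanced_colouring (m1 + (m - m1)) (M - 2 * m1 + (N - 2 * (m - m1))) \<alpha> (4 * 2 ^ k')"
        using that(1) by (rule balanced_colouring_step[rotated])
      also have "m1 + (m - m1) = m" using that by simp
      also have "M - 2 * m1 + (N - 2 * (m - m1)) = n" using that N by linarith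
      finally show ?thesis by (simp add: 3(1) power_add)
    qed
    have "k' = 0 \<or> k' = 2 * (k' div 2 - 1) + 2 \<or> k' = 2 * (k' div 2 - 1) + 3" using 3(2) by linarith
    then consider "k' = 0" | s where "k' = 2 * s + 2" | s where "k' = 2 * s + 3" by blast
    then show ?thesis
    proof cases
      case 1
      \<comment> \<open>As many Shrikhande coordinates as possible. M is odd, so a full Latin part
        keeps one K4 coordinate; then the excess weighs at most 4N - 3N = N.\<close>
      let ?m = "min m ((M - 1) div 2)"
      have M: "M = \<alpha>" by (simp add: M_def 1)
      have le: "2 * ?m \<le> M" by linarith
      have "latin 1 (?m * 1 + (M - 2 * ?m) * 0) (?m * 0 + (M - 2 * ?m) * 1) (?m * 2 + (M - 2 * ?m) * 1)"
        by (intro latin_add latin_copies latin_shrikhande latin_K4)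
      also have "?m * 2 + (M - 2 * ?m) * 1 = \<alpha>" using le M by linarith
      finally have "latin (2 ^ k') ?m (M - 2 * ?m) \<alpha>" by (simp add: 1)
      moreover have "2 * (m - ?m) \<le> N"
      proof -
        obtain r where r: "M = 2 * r + 1" using assms M by (auto elim: oddE)
        have "m \<le> 2 * N" using N(1) by linarith
        moreover have "3 * N = 2 * r" using N(2) r by simp
        ultimately have "2 * (m - r) \<le> N" by (cases "m \<le> r") (auto simp: not_le less_iff_Suc_add)
        then show ?thesis using r by (simp add: min_def)
      qed
      ultimately show ?thesis using le by (intro step) auto
    next
      case 2
      define Q where "Q = \<alpha> * 4 ^ s"
      have M: "M = 4 * Q" and w: "2 ^ k' = (4 ^ s * 4 :: nat)"
        by (simp_all add: M_def Q_def 2 power_add power_mult)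
      show ?thesis
      proof (cases "m = 1 \<and> n = 3")
        case True
        then have "\<alpha> * 2 ^ k = 16" using less.prems(1) by simp
        moreover have "Q = 1" using True N M by simp
        ultimately have "\<alpha> = 1" "2 ^ k = (16 :: nat)" by (simp_all add: Q_def)
        then show ?thesis using balanced_colouring_1_3 True by simp
      next
        case False
        let ?j = "min (m div 2) Q"
        have "latin (4 ^ s * 4) (2 * ?j) (2 * 2 * (Q - ?j)) \<alpha>"
          unfolding Q_def
          by (rule latin_family) (use latin_shrikhande_4 latin_K4_4 in simp_all)
        also have "2 * 2 * (Q - ?j) = M - 2 * (2 * ?j)" by (simp add: M diff_mult_distrib2)
        finally have "latin (2 ^ k') (2 * ?j) (M - 2 * (2 * ?j)) \<alpha>" unfolding w .
        moreover have "2 * (m - 2 * ?j) \<le> N"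
        proof (cases "m div 2 \<le> Q")
          case True
          \<comment> \<open>At most one Shrikhande coordinate, of weight 2, is left over; it fails
            to fit only for N = 1, which is the excluded graph \<open>D(1,3)\<close>.\<close>
          have "N \<noteq> 0"
          proof
            assume "N = 0"
            then have "4 * Q = 1" using N(2) M by simp
            then show False by (cases Q) auto
          qed
          then have "N = 1 \<or> N \<ge> 2" by linarith
          then have "2 * (m mod 2) \<le> N"
          proof
            assume "N = 1"
            then have "m \<le> 2" using N(1) by linarith
            moreover have "m \<noteq> 1" using N(1) False \<open>N = 1\<close> by auto
            ultimately have "m = 0 \<or> m = 2" by linarith
            then show ?thesis by auto
          qed simp
          then show ?thesis using True by (simp add: minus_mult_div_eq_mod)
        next
          case F: False
          then have "?j = Q" by simp
          then show ?thesis using N M by linarith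
        qed
        ultimately show ?thesis by (intro step) (auto simp: M)
      qed
    next
      case (3 s)
      define Q where "Q = \<alpha> * 4 ^ s"
      have M: "M = 8 * Q" and w: "2 ^ k' = (4 ^ s * 8 :: nat)"
        by (simp_all add: M_def Q_def 3 power_add power_mult)
      \<comment> \<open>Up to three Shrikhande coordinates, of weight 6, may be left over, and Q = 2
        would give N = 5 by 8Q = 3N + 1.\<close>
      have "Q \<noteq> 2"
      proof (cases s)
        case 0
        then show ?thesis using assms by (auto simp: Q_def)
      next
        case (Suc r)
        then have "4 dvd Q" by (simp add: Q_def)
        then show ?thesis by auto
      qed
      let ?j = "min (m div 4) Q"
      have "latin (4 ^ s * 8) (4 * ?j) (2 * 4 * (Q - ?j)) \<alpha>"
        unfolding Q_def
        by (rule latin_family) (use latin_shrikhande_8 latin_K4_8 in simp_all)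
      also have "2 * 4 * (Q - ?j) = M - 2 * (4 * ?j)" by (simp add: M diff_mult_distrib2)
      finally have "latin (2 ^ k') (4 * ?j) (M - 2 * (4 * ?j)) \<alpha>" unfolding w .
      moreover have "2 * (m - 4 * ?j) \<le> N"
      proof (cases "m div 4 \<le> Q")
        case True
        have "m mod 4 \<le> 3" by simp
        moreover have "N \<ge> 6"
        proof (rule ccontr)
          assume "\<not> N \<ge> 6"
          then have "Q < 3" using N(2) M by linarith
          with \<open>Q \<noteq> 2\<close> have "Q = 0 \<or> Q = 1" by linarith
          then have "3 * N + 1 = 0 \<or> 3 * N + 1 = 8" using N(2) M by auto
          then show False by (cases "N \<le> 2") linarith+
        qed
        ultimately have "2 * (m mod 4) \<le> N" by linarith
        then show ?thesis using True by (simp add: minus_mult_div_eq_mod)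
      next
        case False
        then have "?j = Q" by simp
        then show ?thesis using N M by linarith
      qed
      ultimately show ?thesis by (intro step) (auto simp: M)
    qed
  qed
qed

text \<open>The separate disjunct accounts for the full vertex set, which is a code whatever 2m + n
  is modulo 4.\<close>

theorem theorem10:
  fixes m n c \<alpha> k :: nat
  assumes "2 * m + n \<ge> 1"
    and "c > 0"
    and "odd \<alpha>"
    and "6 * m + 3 * n + 1 = \<alpha> * 2 ^ k"
  shows "(\<exists>C. multifold_perfect_code (doob_verts m n) doob_adj c C) \<longleftrightarrow>
           c = 6 * m + 3 * n + 1 \<or>
           ([2 * m + n = 1] (mod 4) \<and> (\<exists>l\<in>{1..2 ^ k}. c = \<alpha> * l))"
proof
  assume "\<exists>C. multifold_perfect_code (doob_verts m n) doob_adj c C"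
  then show "c = 6 * m + 3 * n + 1 \<or> ([2 * m + n = 1] (mod 4) \<and> (\<exists>l\<in>{1..2 ^ k}. c = \<alpha> * l))"
    using perfect_code_imp_cong perfect_code_multiplicity[OF _ assms(3,4,2)] by blast
next
  assume "c = 6 * m + 3 * n + 1 \<or> ([2 * m + n = 1] (mod 4) \<and> (\<exists>l\<in>{1..2 ^ k}. c = \<alpha> * l))"
  then show "\<exists>C. multifold_perfect_code (doob_verts m n) doob_adj c C"
  proof
    assume "c = 6 * m + 3 * n + 1"
    then show ?thesis using doob_verts_multifold_perfect[of m n] by blast
  next
    assume c: "[2 * m + n = 1] (mod 4) \<and> (\<exists>l\<in>{1..2 ^ k}. c = \<alpha> * l)"
    then have "(2 * m + n) mod 4 = 1" by (simp add: cong_def)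
    then obtain q where q: "2 * m + n = 4 * q + 1"
      using mult_div_mod_eq[of 4 "2 * m + n"] by metis
    \<comment> \<open>The congruence makes 6m + 3n + 1 = 4(3q + 1) divisible by 4.\<close>
    have "k \<noteq> 1"
    proof
      assume "k = 1"
      then have "\<alpha> = 2 * (3 * q + 1)" using q assms(4) by simp
      with assms(3) show False by simp
    qed
    then have "balanced_colouring m n \<alpha> (2 ^ k)"
      using balanced_colouring_exists[OF assms(3,4)] by blast
    moreover have "\<alpha> > 0" using assms(3) by (cases \<alpha>) auto
    ultimately show ?thesis using perfect_code_of_balanced_colouring c by blast
  qed
qed

end
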